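(* Let $n$ individuals be partitioned into two groups $P_1$ and $P_2$ of sizes $s_1$ and $s_2$ respectively (so $n=s_1+s_2$), with payoffs as in the context. Under the assumption $c<y_3$, the efficient structure has equal or more interconnections than the pairwise stable structure. Moreover, the efficient structure is the pairwise stable structure if (i) for $\delta\ge\max_{s\in\{s_1,s_2\}}\frac{s-3}{n-3}$, $$F_{12}\in\left[0,\frac{c\,\delta}{y_1(s_1)y_1(s_2)}\right]\cup\left[\max_{s\in\{s_1,s_2\}}\frac{c}{y_1(s)},\ \frac{2c}{y_2(s_2)+y_2(s_1)+(s_1+s_2-4)\,\delta y_3}\right]\cup\left[\frac{c}{y_3},1\right];$$ or (ii) for $\delta<\max_{s\in\{s_1,s_2\}}\frac{s-3}{n-3}$, $$F_{12}\in\left[0,\frac{c\,\delta}{y_1(s_1)y_1(s_2)}\right]\cup\left[\frac{c}{y_3},1\right].$$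
   Context: Setting. $V$ is a set of $n$ individuals partitioned into two disjoint groups $P_1,P_2$ with sizes $s_\gamma=|P_\gamma|\ge 3$. $F\in\mathbb{R}^{2\times 2}$ is a symmetric matrix with entries in $[0,1]$ and diagonal entries equal to $1$. For $i\in P_\alpha$, $j\in P_\beta$, $i\ne j$, put $\hat F_{ij}=F_{\alpha\beta}$, and $\hat F_{ii}=0$. Constants: $\delta$ with $0<\delta<1$ is the one-hop benefit, and $c$ is the cost of each link. A network is a set $\mathcal{E}$ of undirected edges between distinct individuals of $V$; $d_{ij}(\mathcal{E})$ is the graph distance ($\infty$ if there is no path, with $\delta^{\infty}=0$), and $N_i(\mathcal{E})$ is the set of neighbors of $i$. The payoff of $i$ is $U_i(\mathcal{E})=\sum_{k\in V}\hat F_{ik}\,\delta^{d_{ik}(\mathcal{E})}-c\,|N_i(\mathcal{E})|$. The value (social welfare) is $v(\mathcal{E})=\sum_{i\in V}U_i(\mathcal{E})$; $\mathcal{E}$ is an efficient structure if it maximizes $v$ over all possible edge sets on $V$. Thresholds: $y_1(s)=\delta+(s-1)\delta^2$, $y_2(s)=(1-\delta)y_1(s)=\delta-\delta^2+(s-1)\delta^2-(s-1)\delta^3$, $y_3=\delta-\delta^2$. Pairwise stability. $\mathcal{E}$ is pairwise stable if for every edge $(i,j)\in\mathcal{E}$, $U_i(\mathcal{E})\ge U_i(\mathcal{E}\setminus\{(i,j)\})$ and $U_j(\mathcal{E})\ge U_j(\mathcal{E}\setminus\{(i,j)\})$; and for every non-edge $(i,j)\notin\mathcal{E}$, if $U_i(\mathcal{E})<U_i(\mathcal{E}\cup\{(i,j)\})$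 then $U_j(\mathcal{E})>U_j(\mathcal{E}\cup\{(i,j)\})$. An interconnection is an edge between an individual of $P_1$ and an individual of $P_2$.
   Formalization: Structures are not unique: claims hold for all efficient/stable structures except at ties (F12=c/y3; s1=s2 with F12=c/((1+δ)y3); endpoints cδ/(y1y1), 2c/(…), and, if s1=s2, max c/y1), where only existence or one-sided comparisons are stated. *)

theory Defs
  imports "HOL-Analysis.Analysis" "HOL-Library.Extended_Nat"
begin

text \<open>
  Groups are indexed by the two-element type \<open>2\<close>. A network on a vertex set \<open>V\<close> is a set
  of two-element subsets of \<open>V\<close>, so that edges are undirected and there are no loops.
\<close>

definition network :: "'a set \<Rightarrow> 'a set set \<Rightarrow> bool" where
  "network V E \<longleftrightarrow> E \<subseteq> {e. e \<subseteq> V \<and> card e = 2}"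

definition adj :: "'a set set \<Rightarrow> ('a \<times> 'a) set" where
  "adj E = {(i, j). {i, j} \<in> E}"

definition nbrs :: "'a set set \<Rightarrow> 'a \<Rightarrow> 'a set" where
  "nbrs E i = {j. {i, j} \<in> E}"

text \<open>The infimum over the empty set of walk lengths is \<open>\<infinity>\<close>.\<close>

definition graph_dist :: "'a set set \<Rightarrow> 'a \<Rightarrow> 'a \<Rightarrow> enat" where
  "graph_dist E i j = Inf {enat m |m. (i, j) \<in> adj E ^^ m}"

definition decay :: "real \<Rightarrow> enat \<Rightarrow> real" where
  "decay \<delta> d = (case d of enat m \<Rightarrow> \<delta> ^ m | \<infinity> \<Rightarrow> 0)"

text \<open>Only meaningful for members of \<open>P 1 \<union> P 2\<close>, with \<open>P 1\<close> and \<open>P 2\<close> disjoint.\<close>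

definition group_of :: "(2 \<Rightarrow> 'a set) \<Rightarrow> 'a \<Rightarrow> 2" where
  "group_of P i = (if i \<in> P 1 then 1 else 2)"

definition Fhat :: "(2 \<Rightarrow> 'a set) \<Rightarrow> real^2^2 \<Rightarrow> 'a \<Rightarrow> 'a \<Rightarrow> real" where
  "Fhat P F i j = (if i = j then 0 else F $ group_of P i $ group_of P j)"

definition payoff ::
    "'a set \<Rightarrow> (2 \<Rightarrow> 'a set) \<Rightarrow> real^2^2 \<Rightarrow> real \<Rightarrow> real \<Rightarrow> 'a set set \<Rightarrow> 'a \<Rightarrow> real" where
  "payoff V P F \<delta> c E i =
     (\<Sum>k\<in>V. Fhat P F i k * decay \<delta> (graph_dist E i k)) - c * real (card (nbrs E i))"

definition welfare ::
    "'a set \<Rightarrow> (2 \<Rightarrow> 'a set) \<Rightarrow> real^2^2 \<Rightarrow> real \<Rightarrow> real \<Rightarrow> 'a set set \<Rightarrow> real" where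
  "welfare V P F \<delta> c E = (\<Sum>i\<in>V. payoff V P F \<delta> c E i)"

definition efficient ::
    "'a set \<Rightarrow> (2 \<Rightarrow> 'a set) \<Rightarrow> real^2^2 \<Rightarrow> real \<Rightarrow> real \<Rightarrow> 'a set set \<Rightarrow> bool" where
  "efficient V P F \<delta> c E \<longleftrightarrow>
     network V E \<and> (\<forall>E'. network V E' \<longrightarrow> welfare V P F \<delta> c E' \<le> welfare V P F \<delta> c E)"

definition pairwise_stable ::
    "'a set \<Rightarrow> (2 \<Rightarrow> 'a set) \<Rightarrow> real^2^2 \<Rightarrow> real \<Rightarrow> real \<Rightarrow> 'a set set \<Rightarrow> bool" where
  "pairwise_stable V P F \<delta> c E \<longleftrightarrow>
     network V E \<and>
     (\<forall>i j. {i, j} \<in> E \<longrightarrow>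
        payoff V P F \<delta> c E i \<ge> payoff V P F \<delta> c (E - {{i, j}}) i \<and>
        payoff V P F \<delta> c E j \<ge> payoff V P F \<delta> c (E - {{i, j}}) j) \<and>
     (\<forall>i\<in>V. \<forall>j\<in>V. i \<noteq> j \<and> {i, j} \<notin> E \<longrightarrow>
        payoff V P F \<delta> c E i < payoff V P F \<delta> c (E \<union> {{i, j}}) i \<longrightarrow>
        payoff V P F \<delta> c E j > payoff V P F \<delta> c (E \<union> {{i, j}}) j)"

definition interconnections :: "(2 \<Rightarrow> 'a set) \<Rightarrow> 'a set set \<Rightarrow> 'a set set" where
  "interconnections P E = {e \<in> E. \<exists>i\<in>P 1. \<exists>j\<in>P 2. e = {i, j}}"

definition y1 :: "real \<Rightarrow> nat \<Rightarrow> real" where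
  "y1 \<delta> s = \<delta> + (real s - 1) * \<delta>\<^sup>2"

definition y2 :: "real \<Rightarrow> nat \<Rightarrow> real" where
  "y2 \<delta> s = (1 - \<delta>) * y1 \<delta> s"

definition y3 :: "real \<Rightarrow> real" where
  "y3 \<delta> = \<delta> - \<delta>\<^sup>2"

text \<open>
  The three end points of the intervals for \<open>F $ 1 $ 2\<close> that are not \<open>0\<close>, \<open>1\<close> or \<open>c / y3 \<delta>\<close>.
\<close>

definition isolation_bound :: "real \<Rightarrow> real \<Rightarrow> nat \<Rightarrow> nat \<Rightarrow> real" where
  "isolation_bound \<delta> c s1 s2 = c * \<delta> / (y1 \<delta> s1 * y1 \<delta> s2)"

definition bridge_lower :: "real \<Rightarrow> real \<Rightarrow> nat \<Rightarrow> nat \<Rightarrow> real" where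
  "bridge_lower \<delta> c s1 s2 = (MAX s\<in>{s1, s2}. c / y1 \<delta> s)"

definition bridge_upper :: "real \<Rightarrow> real \<Rightarrow> nat \<Rightarrow> nat \<Rightarrow> real" where
  "bridge_upper \<delta> c s1 s2 =
     2 * c / (y2 \<delta> s2 + y2 \<delta> s1 + (real s1 + real s2 - 4) * \<delta> * y3 \<delta>)"

text \<open>
  Efficient and pairwise stable networks are determined up to relabelling except where payoffs tie.
  With \<open>f = F $ 1 $ 2\<close> and both groups complete, the ties that matter are the following.
  At \<open>f = c / y3 \<delta>\<close> the efficient networks, which are then also the stable ones, have
  different numbers of interconnections; the same happens at
  \<open>f = c / ((1 + \<delta>) * y3 \<delta>)\<close> if the groups have equal size \<open>s\<close>, where matchings with
  \<open>s - 1\<close> and with \<open>s\<close> interconnections are efficient and stable.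
  At \<open>f = isolation_bound\<close> zero or one, and at \<open>f = bridge_upper\<close> one or two,
  interconnections are efficient, but only the smaller number is stable.
  At \<open>f = bridge_lower\<close> with groups of equal size, zero and one are stable, but zero is not efficient.
\<close>

end

theory Submission
  imports Defs
begin

text \<open>
  Adding a link inside a group gains each end at least \<open>y3 \<delta> - c > 0\<close>, so in efficient and in
  stable networks both groups are cliques and only the interconnections matter. If
  \<open>f = F $ 1 $ 2\<close> satisfies \<open>f * y3 \<delta> > c\<close>, both are the complete network; if
  \<open>f * y3 \<delta> = c\<close>, both mean that no two individuals of different groups are both without
  interconnections (or \<open>f = 0\<close>). If \<open>f * y3 \<delta> < c\<close>, a second interconnection at an
  individual never pays, so stable networks are matchings between the groups, and some matching is
  efficient. Going from \<open>k\<close> to \<open>k + 1\<close> matched pairs adds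
  \<open>2 * (f * surplus k - c)\<close> to the welfare and \<open>f * marginal s k - c\<close> to the payoff of a
  newly matched individual, \<open>s\<close> being the size of the other group. As \<open>surplus\<close> is strictly
  decreasing and at least \<open>marginal\<close>, stability stops adding links no later than welfare does.
\<close>

subsection \<open>Distances and networks\<close>

text \<open>Everything is reduced to the sequence \<open>surplus\<close>: between two cliques every
  cross distance is 1, 2, 3 or infinite, so the welfare depends only on the number of
  interconnections and on how many individuals of each group carry one. The first interconnection is
  special: it lowers infinite distances, whereas later ones lower distances 3 and 2. Hence
  \<open>surplus 0\<close> and \<open>marginal s 0\<close> have formulas of their own, and index 0
  is treated apart throughout. The bounds on \<open>f\<close> mark the steps that break even:
  \<open>isolation_bound\<close> is \<open>c / surplus 0\<close>, \<open>bridge_upper\<close> is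
  \<open>c / surplus 1\<close>, and \<open>bridge_lower\<close> is the least \<open>f\<close> at
  which both ends keep the only interconnection. The two intervals below
  \<open>c / y3 \<delta>\<close> are therefore one argument, for an optimal number \<open>r\<close>
  of interconnections equal to 0 or 1. The obstacle is the ties: several sizes can be optimal at
  once, and networks that are not matchings can be efficient, so the comparison speaks of sizes and
  keeps weak and strict steps apart.\<close>

lemma graph_dist_le: "(i, j) \<in> adj E ^^ m \<Longrightarrow> graph_dist E i j \<le> enat m"
  unfolding graph_dist_def by (rule Inf_lower) auto

lemma graph_dist_ge:
  assumes "\<And>k. k < m \<Longrightarrow> (i, j) \<notin> adj E ^^ k"
  shows "enat m \<le> graph_dist E i j"
  unfolding graph_dist_def
proof (rule Inf_greatest)
  fix x assume "x \<in> {enat m |m. (i, j) \<in> adj E ^^ m}"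
  then obtain k where "x = enat k" "(i, j) \<in> adj E ^^ k" by blast
  then show "enat m \<le> x" using assms[of k] by (cases "k < m") auto
qed

lemma graph_dist_mono:
  assumes "E \<subseteq> E'"
  shows "graph_dist E' i j \<le> graph_dist E i j"
proof -
  have "adj E \<subseteq> adj E'" using assms by (auto simp: adj_def)
  have "adj E ^^ m \<subseteq> adj E' ^^ m" for m
  proof (induction m)
    case (Suc m)
    then show ?case using \<open>adj E \<subseteq> adj E'\<close> by (simp add: relcomp_mono)
  qed simp
  then show ?thesis
    unfolding graph_dist_def by (intro Inf_superset_mono) blast
qed

lemma graph_dist_eq_1:
  assumes "i \<noteq> j" "{i, j} \<in> E"
  shows "graph_dist E i j = 1"
proof (rule antisym)
  show "graph_dist E i j \<le> 1"
    using assms graph_dist_le[of i j 1 E] by (simp add: adj_def one_enat_def)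
  show "1 \<le> graph_dist E i j"
    using assms graph_dist_ge[of 1 i j E] by (simp add: one_enat_def)
qed

lemma graph_dist_ge_2:
  assumes "i \<noteq> j" "{i, j} \<notin> E"
  shows "enat 2 \<le> graph_dist E i j"
proof (rule graph_dist_ge)
  fix k :: nat assume "k < 2"
  then have "k = 0 \<or> k = 1" by auto
  then show "(i, j) \<notin> adj E ^^ k" using assms by (auto simp: adj_def)
qed

lemma decay_enat [simp]: "decay \<delta> (enat m) = \<delta> ^ m"
  by (simp add: decay_def)

lemma decay_1 [simp]: "decay \<delta> 1 = \<delta>"
  by (simp add: one_enat_def)

lemma decay_infinity [simp]: "decay \<delta> \<infinity> = 0"
  by (simp add: decay_def)

lemma decay_antimono:
  assumes "0 < \<delta>" "\<delta> < 1" "d \<le> d'"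
  shows "decay \<delta> d' \<le> decay \<delta> d"
  using assms by (cases d; cases d') (auto intro: power_decreasing)

lemma nbrs_insert:
  assumes "i \<noteq> j"
  shows "nbrs (insert {i, j} E) i = insert j (nbrs E i)"
  using assms by (auto simp: nbrs_def doubleton_eq_iff)

lemma nbrs_insert_other:
  assumes "k \<noteq> i" "k \<noteq> j"
  shows "nbrs (insert {i, j} E) k = nbrs E k"
  using assms by (auto simp: nbrs_def doubleton_eq_iff)

lemma nbrs_sym: "i \<in> nbrs E j \<longleftrightarrow> j \<in> nbrs E i"
  by (simp add: nbrs_def insert_commute)

lemma network_edgeD:
  assumes "network V E" "{i, j} \<in> E"
  shows "i \<in> V" "j \<in> V" "i \<noteq> j"
  using assms by (auto simp: network_def)

lemma network_nbrs: "network V E \<Longrightarrow> nbrs E i \<subseteq> V - {i}"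
  using network_edgeD[of V E i] by (auto simp: nbrs_def)

lemma network_insert:
  "\<lbrakk>network V E; i \<in> V; j \<in> V; i \<noteq> j\<rbrakk> \<Longrightarrow> network V (insert {i, j} E)"
  by (auto simp: network_def)

lemma network_diff: "network V E \<Longrightarrow> network V (E - X)"
  by (auto simp: network_def)

lemma finite_networks:
  assumes "finite V"
  shows "finite {E. network V E}"
proof (rule finite_subset)
  show "{E. network V E} \<subseteq> Pow (Pow V)" by (auto simp: network_def)
qed (use assms in simp)

text \<open>There are finitely many networks, so the maximum is attained. An optimum to compare with
  is also what turns necessary conditions for efficiency into sufficient ones later.\<close>

lemma efficient_exists:
  assumes "finite V"
  shows "\<exists>E. efficient V P F \<delta> c E"
proof -
  let ?N = "{E. network V E}"
  have "?N \<noteq> {}" by (auto simp: network_def)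
  then obtain E where "is_arg_min (\<lambda>E. - welfare V P F \<delta> c E) (\<lambda>E. E \<in> ?N) E"
    using ex_is_arg_min_if_finite[OF finite_networks[OF assms]] by blast
  then show ?thesis by (auto simp: efficient_def is_arg_min_linorder)
qed

text \<open>Results about the groups are stated for an arbitrary ordered pair of distinct indices,
  so that one proof serves both orientations; this rule separates them where the concrete groups
  matter.\<close>

lemma two_cases:
  fixes \<alpha> \<beta> :: 2
  assumes "\<alpha> \<noteq> \<beta>"
  obtains "\<alpha> = 1" "\<beta> = 2" | "\<alpha> = 2" "\<beta> = 1"
  using assms exhaust_2 by metis

lemma sum_if_mem:
  fixes x y :: real
  assumes "finite B" "D \<subseteq> B"
  shows "(\<Sum>k\<in>B. if k \<in> D then x else y) = real (card D) * x + (real (card B) - real (card D)) * y"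
proof -
  have "finite D" using assms finite_subset by blast
  then have "real (card (B - D)) = real (card B) - real (card D)"
    using assms by (simp add: card_Diff_subset card_mono of_nat_diff)
  moreover have "B \<inter> {k. k \<in> D} = D" "B \<inter> - {k. k \<in> D} = B - D" using assms by auto
  ultimately show ?thesis using assms by (simp add: sum.If_cases)
qed

lemma relpow_2_iff: "(i, k) \<in> R ^^ 2 \<longleftrightarrow> (\<exists>l. (i, l) \<in> R \<and> (l, k) \<in> R)"
  by (auto simp: numeral_2_eq_2 relcomp_unfold)

lemma relpow_3_iff: "(i, k) \<in> R ^^ 3 \<longleftrightarrow> (\<exists>l p. (i, l) \<in> R \<and> (l, p) \<in> R \<and> (p, k) \<in> R)"
  by (auto simp: numeral_3_eq_3 relcomp_unfold)

subsection \<open>Gains from single links\<close>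

locale two_groups =
  fixes V :: "'a set" and P :: "2 \<Rightarrow> 'a set" and F :: "real^2^2" and \<delta> c :: real
  assumes finite_V: "finite V"
    and groups_Un: "P 1 \<union> P 2 = V"
    and groups_disjoint: "P 1 \<inter> P 2 = {}"
    and card_group: "3 \<le> card (P \<alpha>)"
    and F_sym: "transpose F = F"
    and F_range: "F $ \<alpha> $ \<beta> \<in> {0..1}"
    and F_diag: "F $ \<alpha> $ \<alpha> = 1"
    and delta_pos: "0 < \<delta>" and delta_less_1: "\<delta> < 1"
    and cost_less: "c < y3 \<delta>"
begin

abbreviation f :: real where "f \<equiv> F $ 1 $ 2"
abbreviation U :: "'a set set \<Rightarrow> 'a \<Rightarrow> real" where "U \<equiv> payoff V P F \<delta> c"
abbreviation W :: "'a set set \<Rightarrow> real" where "W \<equiv> welfare V P F \<delta> c"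

lemma f_nonneg: "0 \<le> f" using F_range[of 1 2] by simp

lemma y3_pos: "0 < y3 \<delta>"
  using delta_pos delta_less_1 by (simp add: y3_def power2_eq_square)

lemma F_off_diag: "\<alpha> \<noteq> \<beta> \<Longrightarrow> F $ \<alpha> $ \<beta> = f"
proof (erule two_cases)
  have "F $ 2 $ 1 = transpose F $ 1 $ 2" by (simp add: transpose_def)
  then show "F $ \<alpha> $ \<beta> = f" if "\<alpha> = 2" "\<beta> = 1" using that F_sym by simp
qed simp

lemma groups_Un': "\<alpha> \<noteq> \<beta> \<Longrightarrow> P \<alpha> \<union> P \<beta> = V"
  using groups_Un by (auto elim: two_cases)

lemma groups_disjoint': "\<alpha> \<noteq> \<beta> \<Longrightarrow> P \<alpha> \<inter> P \<beta> = {}"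
  using groups_disjoint by (auto elim: two_cases)

lemma group_subset: "P \<alpha> \<subseteq> V"
  using groups_Un exhaust_2[of \<alpha>] by auto

lemma finite_group: "finite (P \<alpha>)"
  using group_subset finite_V by (rule finite_subset)

lemma group_of_eq: "i \<in> P \<alpha> \<Longrightarrow> group_of P i = \<alpha>"
  using groups_disjoint exhaust_2[of \<alpha>] by (auto simp: group_of_def)

lemma in_group: "i \<in> V \<Longrightarrow> \<exists>\<alpha>. i \<in> P \<alpha>"
  using groups_Un by auto

lemma Fhat_nonneg: "0 \<le> Fhat P F i j"
  using F_range by (simp add: Fhat_def)

text \<open>No distance grows, and the distance to \<open>j\<close> drops from at least 2 to 1,
  which is worth at least \<open>\<delta> - \<delta>\<^sup>2\<close>. Only the summand of
  \<open>j\<close> needs this sharper estimate.\<close>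

lemma payoff_insert_ge:
  assumes "network V E" "i \<in> V" "j \<in> V" "i \<noteq> j" "{i, j} \<notin> E"
  shows "U E i + Fhat P F i j * y3 \<delta> - c \<le> U (insert {i, j} E) i"
proof -
  let ?E = "insert {i, j} E"
  have fin: "finite (nbrs E i)"
    using network_nbrs[OF assms(1)] finite_V by (metis finite_Diff finite_subset)
  have "j \<notin> nbrs E i" using assms by (simp add: nbrs_def)
  then have card: "card (nbrs ?E i) = card (nbrs E i) + 1"
    using fin by (simp add: nbrs_insert assms)
  have mono: "Fhat P F i k * decay \<delta> (graph_dist E i k) \<le> Fhat P F i k * decay \<delta> (graph_dist ?E i k)" for k
    using delta_pos delta_less_1
    by (intro mult_left_mono decay_antimono graph_dist_mono Fhat_nonneg) auto
  have "decay \<delta> (graph_dist E i j) \<le> decay \<delta> (enat 2)"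
    using assms delta_pos delta_less_1 by (intro decay_antimono graph_dist_ge_2)
  moreover have "graph_dist ?E i j = 1" using assms by (simp add: graph_dist_eq_1)
  ultimately have "decay \<delta> (graph_dist E i j) + y3 \<delta> \<le> decay \<delta> (graph_dist ?E i j)"
    by (simp add: y3_def)
  from mult_left_mono[OF this Fhat_nonneg[of i j]]
  have "Fhat P F i j * decay \<delta> (graph_dist E i j) + Fhat P F i j * y3 \<delta>
      \<le> Fhat P F i j * decay \<delta> (graph_dist ?E i j)" by (simp add: distrib_left)
  moreover have "(\<Sum>k\<in>V - {j}. Fhat P F i k * decay \<delta> (graph_dist E i k))
      \<le> (\<Sum>k\<in>V - {j}. Fhat P F i k * decay \<delta> (graph_dist ?E i k))"
    by (rule sum_mono) (rule mono)
  ultimately show ?thesis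
    using finite_V assms(3) card unfolding payoff_def by (simp add: sum.remove[of V j] algebra_simps)
qed

lemma payoff_insert_other_ge:
  assumes "k \<noteq> i" "k \<noteq> j"
  shows "U E k \<le> U (insert {i, j} E) k"
  unfolding payoff_def nbrs_insert_other[OF assms]
  using delta_pos delta_less_1
  by (intro diff_right_mono sum_mono mult_left_mono decay_antimono graph_dist_mono Fhat_nonneg) auto

lemma Fhat_commute: "Fhat P F i j = Fhat P F j i"
  using F_off_diag[of "group_of P i" "group_of P j"] F_off_diag[of "group_of P j" "group_of P i"]
  by (cases "group_of P i = group_of P j") (auto simp: Fhat_def)

text \<open>\<open>Fhat\<close> is symmetric, so a missing link of this kind would strictly benefit
  both ends, while bystanders pay nothing and see no distance grow.\<close>

lemma efficient_edge:
  assumes "efficient V P F \<delta> c E" "i \<in> V" "j \<in> V" "i \<noteq> j" "c < Fhat P F i j * y3 \<delta>"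
  shows "{i, j} \<in> E"
proof (rule ccontr)
  assume notin: "{i, j} \<notin> E"
  let ?E = "insert {i, j} E"
  have net: "network V E" using assms by (simp add: efficient_def)
  have "U E i < U ?E i" using payoff_insert_ge[OF net assms(2-4) notin] assms(5) by simp
  moreover have "U E j < U ?E j"
    using payoff_insert_ge[OF net assms(3) assms(2)] assms notin
    by (auto simp: insert_commute Fhat_commute[of j i])
  ultimately have le: "U E k \<le> U ?E k" for k
    using payoff_insert_other_ge[of k i j E] by (cases "k = i"; cases "k = j") auto
  have "W E < W ?E"
    unfolding welfare_def
    by (rule sum_strict_mono_ex1) (use finite_V assms \<open>U E i < U ?E i\<close> le in auto)
  moreover have "W ?E \<le> W E"
    using assms network_insert[OF net] by (simp add: efficient_def)
  ultimately show False by simp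
qed

lemma stable_edge:
  assumes "pairwise_stable V P F \<delta> c E" "i \<in> V" "j \<in> V" "i \<noteq> j" "c < Fhat P F i j * y3 \<delta>"
  shows "{i, j} \<in> E"
proof (rule ccontr)
  assume notin: "{i, j} \<notin> E"
  let ?E = "insert {i, j} E"
  have net: "network V E" using assms by (simp add: pairwise_stable_def)
  have "U E i < U ?E i" using payoff_insert_ge[OF net assms(2-4) notin] assms(5) by simp
  moreover have "U E j < U ?E j"
    using payoff_insert_ge[OF net assms(3) assms(2)] assms notin
    by (auto simp: insert_commute Fhat_commute[of j i])
  ultimately show False
    using assms notin by (force simp: pairwise_stable_def)
qed

definition clustered :: "'a set set \<Rightarrow> bool" where
  "clustered E \<longleftrightarrow> network V E \<and> (\<forall>\<alpha>. \<forall>i\<in>P \<alpha>. \<forall>j\<in>P \<alpha>. i \<noteq> j \<longrightarrow> {i, j} \<in> E)"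

lemma Fhat_same: "\<lbrakk>i \<in> P \<alpha>; j \<in> P \<alpha>; i \<noteq> j\<rbrakk> \<Longrightarrow> Fhat P F i j = 1"
  by (simp add: Fhat_def group_of_eq F_diag)

lemma Fhat_cross:
  assumes "\<alpha> \<noteq> \<beta>" "i \<in> P \<alpha>" "j \<in> P \<beta>"
  shows "Fhat P F i j = f"
  using assms groups_disjoint'[OF assms(1)] F_off_diag[OF assms(1)] by (auto simp: Fhat_def group_of_eq)

lemma same_group_gain: "\<lbrakk>i \<in> P \<alpha>; j \<in> P \<alpha>; i \<noteq> j\<rbrakk> \<Longrightarrow> c < Fhat P F i j * y3 \<delta>"
  using cost_less by (simp add: Fhat_same)

lemma efficient_clustered:
  assumes "efficient V P F \<delta> c E"
  shows "clustered E"
proof -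
  have "network V E" using assms by (simp add: efficient_def)
  then show ?thesis
    unfolding clustered_def
    using efficient_edge[OF assms] same_group_gain group_subset by blast
qed

lemma stable_clustered:
  assumes "pairwise_stable V P F \<delta> c E"
  shows "clustered E"
proof -
  have "network V E" using assms by (simp add: pairwise_stable_def)
  then show ?thesis
    unfolding clustered_def
    using stable_edge[OF assms] same_group_gain group_subset by blast
qed

subsection \<open>Payoffs when both groups are cliques\<close>

text \<open>Who is touched decides between distances 2 and 3 for cross pairs that are not linked, so
  these two sets carry all the information needed beyond the links themselves.\<close>

definition touched :: "'a set set \<Rightarrow> 2 \<Rightarrow> 2 \<Rightarrow> 'a set" where
  "touched E \<alpha> \<beta> = {i \<in> P \<alpha>. nbrs E i \<inter> P \<beta> \<noteq> {}}"

lemma touched_subset: "touched E \<alpha> \<beta> \<subseteq> P \<alpha>"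
  by (auto simp: touched_def)

lemma finite_touched: "finite (touched E \<alpha> \<beta>)"
  using touched_subset finite_group by (rule finite_subset)

lemma touched_card_le: "card (touched E \<alpha> \<beta>) \<le> card (P \<alpha>)"
  using touched_subset finite_group by (metis card_mono)

lemma clustered_network: "clustered E \<Longrightarrow> network V E"
  by (simp add: clustered_def)

lemma clustered_edge: "\<lbrakk>clustered E; i \<in> P \<alpha>; j \<in> P \<alpha>; i \<noteq> j\<rbrakk> \<Longrightarrow> {i, j} \<in> E"
  by (auto simp: clustered_def)

lemma cross_neq: "\<lbrakk>\<alpha> \<noteq> \<beta>; i \<in> P \<alpha>; j \<in> P \<beta>\<rbrakk> \<Longrightarrow> i \<noteq> j"
  using groups_disjoint'[of \<alpha> \<beta>] by auto

lemma clustered_insert: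
  assumes "clustered E" "\<alpha> \<noteq> \<beta>" "i \<in> P \<alpha>" "j \<in> P \<beta>"
  shows "clustered (insert {i, j} E)"
  unfolding clustered_def
proof
  show "network V (insert {i, j} E)"
    using assms group_subset cross_neq[OF assms(2-4)] by (blast intro: network_insert clustered_network)
qed (use assms clustered_edge in auto)

lemma clustered_diff:
  assumes "clustered E" "\<alpha> \<noteq> \<beta>" "i \<in> P \<alpha>" "j \<in> P \<beta>"
  shows "clustered (E - {{i, j}})"
proof -
  have "{k, l} \<noteq> {i, j}" if "k \<in> P \<gamma>" "l \<in> P \<gamma>" for k l \<gamma>
  proof
    assume "{k, l} = {i, j}"
    then have "i \<in> P \<gamma>" "j \<in> P \<gamma>" using that by (auto simp: doubleton_eq_iff)
    then show False using assms group_of_eq by metis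
  qed
  then show ?thesis
    using assms(1) network_diff by (auto simp: clustered_def)
qed

lemma nbrs_clustered:
  assumes "clustered E" "\<alpha> \<noteq> \<beta>" "i \<in> P \<alpha>"
  shows "nbrs E i = (P \<alpha> - {i}) \<union> (nbrs E i \<inter> P \<beta>)"
proof -
  have "nbrs E i \<subseteq> V - {i}" using assms by (intro network_nbrs clustered_network)
  moreover have "P \<alpha> - {i} \<subseteq> nbrs E i"
    using clustered_edge[OF assms(1) assms(3)] by (auto simp: nbrs_def)
  ultimately show ?thesis using groups_Un'[OF assms(2)] by blast
qed

lemma card_nbrs_clustered:
  assumes "clustered E" "\<alpha> \<noteq> \<beta>" "i \<in> P \<alpha>"
  shows "real (card (nbrs E i)) = real (card (P \<alpha>)) - 1 + real (card (nbrs E i \<inter> P \<beta>))"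
proof -
  have "card (nbrs E i) = card (P \<alpha> - {i}) + card (nbrs E i \<inter> P \<beta>)"
    by (subst nbrs_clustered[OF assms], rule card_Un_disjoint)
      (use finite_group groups_disjoint'[OF assms(2)] in auto)
  moreover have "card (P \<alpha> - {i}) = card (P \<alpha>) - 1" using assms finite_group by simp
  ultimately show ?thesis using card_group[of \<alpha>] by (simp add: of_nat_diff)
qed

text \<open>A shortest path crosses once. Inside a clique one step reaches the crossing link, so the
  path needs at most one step before and one after it; one of them is saved if an end is touched,
  both if the pair is linked.\<close>

lemma decay_cross:
  assumes cl: "clustered E" and ab: "\<alpha> \<noteq> \<beta>" and i: "i \<in> P \<alpha>" and k: "k \<in> P \<beta>"
  shows "decay \<delta> (graph_dist E i k) =
    (if k \<in> nbrs E i then \<delta>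
     else if nbrs E i \<inter> P \<beta> \<noteq> {} \<or> k \<in> touched E \<beta> \<alpha> then \<delta>\<^sup>2
     else if touched E \<beta> \<alpha> \<noteq> {} then \<delta>^3 else 0)"
proof -
  have neq: "i \<noteq> k" using cross_neq[OF ab i k] .
  have V: "P \<alpha> \<union> P \<beta> = V" using groups_Un'[OF ab] .
  have net: "network V E" using cl by (rule clustered_network)
  consider (one) "k \<in> nbrs E i"
    | (two) "k \<notin> nbrs E i" "nbrs E i \<inter> P \<beta> \<noteq> {} \<or> k \<in> touched E \<beta> \<alpha>"
    | (three) "k \<notin> nbrs E i" "nbrs E i \<inter> P \<beta> = {}" "k \<notin> touched E \<beta> \<alpha>" "touched E \<beta> \<alpha> \<noteq> {}"
    | (inf) "touched E \<beta> \<alpha> = {}" "nbrs E i \<inter> P \<beta> = {}" "k \<notin> nbrs E i"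
    by blast
  then show ?thesis
  proof cases
    case one
    then show ?thesis using neq by (simp add: nbrs_def graph_dist_eq_1)
  next
    case two
    have "\<exists>l. {i, l} \<in> E \<and> {l, k} \<in> E"
    proof (cases "nbrs E i \<inter> P \<beta> = {}")
      case False
      then obtain l where l: "l \<in> nbrs E i" "l \<in> P \<beta>" by blast
      then have "l \<noteq> k" using two by auto
      then show ?thesis using l clustered_edge[OF cl l(2) k] by (auto simp: nbrs_def)
    next
      case True
      then obtain l where l: "l \<in> nbrs E k" "l \<in> P \<alpha>" using two by (auto simp: touched_def)
      then have "l \<noteq> i" using two by (auto simp: nbrs_sym[of i])
      then show ?thesis using l clustered_edge[OF cl i l(2)] by (auto simp: nbrs_def insert_commute)
    qed
    then have "graph_dist E i k \<le> enat 2"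
      by (intro graph_dist_le) (auto simp: relpow_2_iff adj_def)
    moreover have "enat 2 \<le> graph_dist E i k"
      using two neq by (intro graph_dist_ge_2) (auto simp: nbrs_def)
    ultimately have "graph_dist E i k = enat 2" by (rule antisym)
    then show ?thesis using two by simp
  next
    case three
    then obtain l p where l: "l \<in> P \<beta>" "p \<in> P \<alpha>" "p \<in> nbrs E l" by (auto simp: touched_def)
    have "l \<noteq> k" using l three by (auto simp: touched_def)
    have "p \<noteq> i" using l three by (auto simp: nbrs_sym[of p])
    have "(i, p) \<in> adj E" "(p, l) \<in> adj E" "(l, k) \<in> adj E"
      using clustered_edge[OF cl i l(2)] clustered_edge[OF cl l(1) k] \<open>l \<noteq> k\<close> \<open>p \<noteq> i\<close> l(3)
      by (auto simp: adj_def nbrs_def insert_commute)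
    then have "(i, k) \<in> adj E ^^ 3" by (auto simp: relpow_3_iff)
    then have "graph_dist E i k \<le> enat 3" by (rule graph_dist_le)
    moreover have "enat 3 \<le> graph_dist E i k"
    proof (rule graph_dist_ge)
      fix m :: nat assume "m < 3"
      then consider "m = 0" | "m = 1" | "m = 2" by linarith
      then show "(i, k) \<notin> adj E ^^ m"
      proof cases
        case 3
        \<comment> \<open>The midpoint of a walk of length 2 lies in one of the groups, and then
          either \<open>i\<close> or \<open>k\<close> would have an interconnection.\<close>
        have "\<not> ({i, l} \<in> E \<and> {l, k} \<in> E)" for l
        proof
          assume l: "{i, l} \<in> E \<and> {l, k} \<in> E"
          then have "l \<in> V" using network_edgeD[OF net] by blast
          then show False
            using V l three k by (auto simp: touched_def nbrs_def insert_commute)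
        qed
        then show ?thesis using 3 by (auto simp: relpow_2_iff adj_def)
      qed (use neq three in \<open>auto simp: adj_def nbrs_def\<close>)
    qed
    ultimately have "graph_dist E i k = enat 3" by (rule antisym)
    then show ?thesis using three by simp
  next
    case inf
    \<comment> \<open>Without interconnections no walk leaves the group of \<open>i\<close>, so the
      distance is an infimum over the empty set.\<close>
    have "(i, l) \<in> adj E ^^ m \<Longrightarrow> l \<in> P \<alpha>" for m l
    proof (induction m arbitrary: l)
      case 0
      then show ?case using i by simp
    next
      case (Suc m)
      then obtain p where p: "p \<in> P \<alpha>" "{p, l} \<in> E" by (auto simp: adj_def)
      then have "l \<in> V" using network_edgeD[OF net] by blast
      then show ?case using V p inf(1) by (auto simp: touched_def nbrs_def insert_commute)
    qed
    then have "\<And>m. (i, k) \<notin> adj E ^^ m" using cross_neq[OF ab _ k] by blast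
    then have "{enat m |m. (i, k) \<in> adj E ^^ m} = {}" by blast
    then have "graph_dist E i k = \<infinity>"
      unfolding graph_dist_def by (simp add: Inf_enat_def)
    then show ?thesis using inf by simp
  qed
qed

text \<open>The decayed benefit of \<open>i\<close> from the other group before weighting by
  \<open>f\<close>: distances 1 and 2 if \<open>i\<close> has \<open>d\<close> interconnections of
  its own, distances 2 and 3 if it relies on those of its group, which reach \<open>t\<close>
  individuals directly.\<close>

definition access :: "'a set set \<Rightarrow> 2 \<Rightarrow> 2 \<Rightarrow> 'a \<Rightarrow> real" where
  "access E \<alpha> \<beta> i =
    (let d = real (card (nbrs E i \<inter> P \<beta>)); t = real (card (touched E \<beta> \<alpha>)); s = real (card (P \<beta>))
     in if d \<noteq> 0 then d * \<delta> + (s - d) * \<delta>\<^sup>2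
        else if t \<noteq> 0 then t * \<delta>\<^sup>2 + (s - t) * \<delta>^3 else 0)"

lemma sum_decay_cross:
  assumes "clustered E" "\<alpha> \<noteq> \<beta>" "i \<in> P \<alpha>"
  shows "(\<Sum>k\<in>P \<beta>. decay \<delta> (graph_dist E i k)) = access E \<alpha> \<beta> i"
proof -
  let ?D = "nbrs E i \<inter> P \<beta>" and ?T = "touched E \<beta> \<alpha>"
  have fin: "finite ?D" "finite ?T" using finite_group finite_touched by auto
  consider "?D \<noteq> {}" | "?D = {}" "?T \<noteq> {}" | "?D = {}" "?T = {}" by blast
  then show ?thesis
  proof cases
    case 1
    then have "(\<Sum>k\<in>P \<beta>. decay \<delta> (graph_dist E i k)) = (\<Sum>k\<in>P \<beta>. if k \<in> ?D then \<delta> else \<delta>\<^sup>2)"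
      by (intro sum.cong refl) (auto simp: decay_cross[OF assms])
    then show ?thesis
      using 1 fin by (simp add: sum_if_mem finite_group access_def Let_def del: Int_iff)
  next
    case 2
    then have "(\<Sum>k\<in>P \<beta>. decay \<delta> (graph_dist E i k)) = (\<Sum>k\<in>P \<beta>. if k \<in> ?T then \<delta>\<^sup>2 else \<delta>^3)"
      by (intro sum.cong refl) (auto simp: decay_cross[OF assms])
    then show ?thesis
      using 2 fin by (simp add: sum_if_mem finite_group touched_subset access_def Let_def)
  next
    case 3
    then have "(\<Sum>k\<in>P \<beta>. decay \<delta> (graph_dist E i k)) = (\<Sum>k\<in>P \<beta>. 0)"
      by (intro sum.cong refl) (auto simp: decay_cross[OF assms])
    then show ?thesis using 3 by (simp add: access_def)
  qed
qed

lemma payoff_clustered: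
  assumes "clustered E" "\<alpha> \<noteq> \<beta>" "i \<in> P \<alpha>"
  shows "U E i = (real (card (P \<alpha>)) - 1) * (\<delta> - c) + f * access E \<alpha> \<beta> i
    - c * real (card (nbrs E i \<inter> P \<beta>))"
proof -
  have "(\<Sum>k\<in>P \<alpha>. Fhat P F i k * decay \<delta> (graph_dist E i k)) = (\<Sum>k\<in>P \<alpha> - {i}. \<delta>)"
  proof (rule sum.mono_neutral_cong_right)
    show "Fhat P F i k * decay \<delta> (graph_dist E i k) = \<delta>" if "k \<in> P \<alpha> - {i}" for k
      using that assms clustered_edge[OF assms(1,3)] by (auto simp: Fhat_same graph_dist_eq_1)
  qed (auto simp: finite_group Fhat_def)
  also have "\<dots> = (real (card (P \<alpha>)) - 1) * \<delta>"
    using card_group[of \<alpha>] assms finite_group by (simp add: of_nat_diff)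
  finally have same: "(\<Sum>k\<in>P \<alpha>. Fhat P F i k * decay \<delta> (graph_dist E i k)) = (real (card (P \<alpha>)) - 1) * \<delta>" .
  have "(\<Sum>k\<in>P \<beta>. Fhat P F i k * decay \<delta> (graph_dist E i k)) = f * access E \<alpha> \<beta> i"
    by (simp add: sum_decay_cross[OF assms, symmetric] Fhat_cross[OF assms(2,3)] sum_distrib_left)
  moreover have "(\<Sum>k\<in>V. Fhat P F i k * decay \<delta> (graph_dist E i k)) =
      (\<Sum>k\<in>P \<alpha>. Fhat P F i k * decay \<delta> (graph_dist E i k)) +
      (\<Sum>k\<in>P \<beta>. Fhat P F i k * decay \<delta> (graph_dist E i k))"
    unfolding groups_Un'[OF assms(2), symmetric]
    by (rule sum.union_disjoint) (use finite_group groups_disjoint'[OF assms(2)] in auto)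
  ultimately show ?thesis
    unfolding payoff_def card_nbrs_clustered[OF assms] using same by (simp add: algebra_simps)
qed

text \<open>The rise of \<open>access\<close> for an individual that gets its first interconnection
  to a group of size \<open>s\<close> with \<open>t\<close> touched members:
  \<open>y3 \<delta>\<close> for the partner, plus \<open>\<delta> * y3 \<delta>\<close> for each of
  the \<open>s - t\<close> members whose distance was 3. For \<open>t = 0\<close> the group was
  unreachable before, and all of \<open>y1 \<delta> s\<close> is gained.\<close>

definition marginal :: "nat \<Rightarrow> nat \<Rightarrow> real" where
  "marginal s t = (if t = 0 then y1 \<delta> s else y3 \<delta> * (1 + (real s - real t) * \<delta>))"

text \<open>The gain is the same for every partner \<open>j\<close>: an untouched \<open>i\<close>
  ends at distance 1 from \<open>j\<close> and 2 from the rest of that group, and a touched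
  \<open>i\<close> was at distance 2 from \<open>j\<close> already.\<close>

lemma payoff_insert_cross:
  assumes cl: "clustered E" and ab: "\<alpha> \<noteq> \<beta>" and i: "i \<in> P \<alpha>" and j: "j \<in> P \<beta>"
    and notin: "{i, j} \<notin> E"
  shows "U (insert {i, j} E) i = U E i - c +
    f * (if i \<in> touched E \<alpha> \<beta> then y3 \<delta> else marginal (card (P \<beta>)) (card (touched E \<beta> \<alpha>)))"
proof -
  let ?E = "insert {i, j} E"
  have neq: "i \<noteq> j" using cross_neq[OF ab i j] .
  have fin: "finite (nbrs E i \<inter> P \<beta>)" using finite_group by auto
  have "nbrs ?E i \<inter> P \<beta> = insert j (nbrs E i \<inter> P \<beta>)" using neq j by (auto simp: nbrs_insert)
  moreover have "j \<notin> nbrs E i \<inter> P \<beta>" using notin by (simp add: nbrs_def)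
  ultimately have card: "card (nbrs ?E i \<inter> P \<beta>) = Suc (card (nbrs E i \<inter> P \<beta>))"
    using fin by simp
  have "i \<in> touched E \<alpha> \<beta> \<longleftrightarrow> card (nbrs E i \<inter> P \<beta>) \<noteq> 0"
    using i fin by (auto simp: touched_def)
  then show ?thesis
    unfolding payoff_clustered[OF cl ab i] payoff_clustered[OF clustered_insert[OF cl ab i j] ab i]
      access_def Let_def card
    by (auto simp: marginal_def y1_def y3_def algebra_simps power2_eq_square power3_eq_cube)
qed

lemma interconnections_eq:
  assumes "\<alpha> \<noteq> \<beta>"
  shows "interconnections P E = (\<lambda>(i, j). {i, j}) ` (SIGMA i:P \<alpha>. nbrs E i \<inter> P \<beta>)"
  using assms
  by (rule two_cases)
    (auto simp: interconnections_def nbrs_def image_iff insert_commute Bex_def)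

text \<open>Disjointness of the groups makes the orientation of a cross pair unique, so cross
  degrees can be summed over either group.\<close>

lemma card_interconnections:
  assumes "\<alpha> \<noteq> \<beta>"
  shows "card (interconnections P E) = (\<Sum>i\<in>P \<alpha>. card (nbrs E i \<inter> P \<beta>))"
proof -
  have "inj_on (\<lambda>(i, j). {i, j}) (SIGMA i:P \<alpha>. nbrs E i \<inter> P \<beta>)"
    using cross_neq[OF assms] by (auto simp: inj_on_def doubleton_eq_iff)
  then show ?thesis
    unfolding interconnections_eq[OF assms]
    by (simp add: card_image card_SigmaI finite_group)
qed

lemma card_touched_sum:
  shows "card (touched E \<alpha> \<beta>) = (\<Sum>i\<in>P \<alpha>. if nbrs E i \<inter> P \<beta> = {} then 0 else 1)"
proof -
  have "card (touched E \<alpha> \<beta>) = (\<Sum>i\<in>touched E \<alpha> \<beta>. 1)" by simp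
  also have "\<dots> = (\<Sum>i\<in>P \<alpha>. if nbrs E i \<inter> P \<beta> = {} then 0 else 1)"
    by (rule sum.mono_neutral_cong_left) (auto simp: touched_def finite_group)
  finally show ?thesis .
qed

lemma card_touched_le:
  assumes "\<alpha> \<noteq> \<beta>"
  shows "card (touched E \<alpha> \<beta>) \<le> card (interconnections P E)"
  unfolding card_touched_sum card_interconnections[OF assms]
  by (rule sum_mono) (auto simp: Suc_le_eq card_gt_0_iff finite_group)

lemma interconnections_eq_0_iff:
  assumes "\<alpha> \<noteq> \<beta>"
  shows "card (interconnections P E) = 0 \<longleftrightarrow> card (touched E \<alpha> \<beta>) = 0"
  unfolding card_touched_sum card_interconnections[OF assms]
  by (auto simp: finite_group)

definition matching :: "'a set set \<Rightarrow> bool" where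
  "matching E \<longleftrightarrow> (\<forall>\<alpha> \<beta>. \<alpha> \<noteq> \<beta> \<longrightarrow> (\<forall>i\<in>P \<alpha>. card (nbrs E i \<inter> P \<beta>) \<le> 1))"

lemma matching_card_touched:
  assumes "matching E" "\<alpha> \<noteq> \<beta>"
  shows "card (touched E \<alpha> \<beta>) = card (interconnections P E)"
  unfolding card_touched_sum card_interconnections[OF assms(2)]
proof (rule sum.cong)
  fix i assume "i \<in> P \<alpha>"
  then have "card (nbrs E i \<inter> P \<beta>) \<le> 1" using assms by (auto simp: matching_def)
  moreover have "card (nbrs E i \<inter> P \<beta>) = 0 \<longleftrightarrow> nbrs E i \<inter> P \<beta> = {}"
    using finite_group by auto
  ultimately show "(if nbrs E i \<inter> P \<beta> = {} then 0 else 1) = card (nbrs E i \<inter> P \<beta>)" by auto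
qed simp

text \<open>The welfare of the two cliques without any interconnection.\<close>

definition base :: real where
  "base = (\<Sum>\<alpha>\<in>UNIV. real (card (P \<alpha>)) * (real (card (P \<alpha>)) - 1) * (\<delta> - c))"

text \<open>Once the groups are connected, count every cross pair at distance 2, add
  \<open>y3 \<delta>\<close> for each linked pair, and subtract
  \<open>\<delta>\<^sup>2 - \<delta>^3 = \<delta> * y3 \<delta>\<close> for each pair whose ends are
  both untouched.\<close>

lemma sum_access:
  assumes "clustered E" "\<alpha> \<noteq> \<beta>"
  defines "m \<equiv> real (card (interconnections P E))"
  shows "(\<Sum>i\<in>P \<alpha>. access E \<alpha> \<beta> i) =
    (if m = 0 then 0 else m * y3 \<delta> + real (card (P \<alpha>)) * real (card (P \<beta>)) * \<delta>\<^sup>2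
      - (real (card (P \<alpha>)) - real (card (touched E \<alpha> \<beta>)))
        * (real (card (P \<beta>)) - real (card (touched E \<beta> \<alpha>))) * \<delta> * y3 \<delta>)"
proof (cases "m = 0")
  case True
  then have "card (touched E \<beta> \<alpha>) = 0" "\<forall>i\<in>P \<alpha>. nbrs E i \<inter> P \<beta> = {}"
    using interconnections_eq_0_iff[of \<beta> \<alpha> E] interconnections_eq_0_iff[of \<alpha> \<beta> E] assms(2) finite_touched
    by (auto simp: m_def touched_def)
  then show ?thesis using True by (simp add: access_def)
next
  case False
  define t where "t = real (card (touched E \<beta> \<alpha>))"
  define z where "z = t * \<delta>\<^sup>2 + (real (card (P \<beta>)) - t) * \<delta>^3"
  define s where "s = real (card (P \<beta>))"
  have "t \<noteq> 0" using False interconnections_eq_0_iff[of \<beta> \<alpha> E] assms(2) by (simp add: t_def m_def)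
  \<comment> \<open>For a touched individual,
    \<open>d * \<delta> + (s - d) * \<delta>\<^sup>2\<close> is rewritten as
    \<open>d * y3 \<delta> + s * \<delta>\<^sup>2\<close>, so that the links separate from the
    touched status.\<close>
  have "(\<Sum>i\<in>P \<alpha>. access E \<alpha> \<beta> i) = (\<Sum>i\<in>P \<alpha>. real (card (nbrs E i \<inter> P \<beta>)) * y3 \<delta>
      + (if i \<in> touched E \<alpha> \<beta> then s * \<delta>\<^sup>2 else z))"
  proof (rule sum.cong)
    fix i assume i: "i \<in> P \<alpha>"
    have "i \<in> touched E \<alpha> \<beta> \<longleftrightarrow> card (nbrs E i \<inter> P \<beta>) \<noteq> 0"
      using i finite_group by (auto simp: touched_def)
    then show "access E \<alpha> \<beta> i = real (card (nbrs E i \<inter> P \<beta>)) * y3 \<delta>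
        + (if i \<in> touched E \<alpha> \<beta> then s * \<delta>\<^sup>2 else z)"
      using \<open>t \<noteq> 0\<close> by (auto simp: access_def Let_def t_def[symmetric] z_def s_def y3_def algebra_simps)
  qed simp
  also have "\<dots> = m * y3 \<delta> + (real (card (touched E \<alpha> \<beta>)) * (s * \<delta>\<^sup>2)
      + (real (card (P \<alpha>)) - real (card (touched E \<alpha> \<beta>))) * z)"
    by (simp add: sum.distrib sum_if_mem finite_group touched_subset m_def
        card_interconnections[OF assms(2)] sum_distrib_right)
  finally show ?thesis
    using False by (simp add: s_def z_def t_def y3_def algebra_simps power2_eq_square power3_eq_cube)
qed

text \<open>What the interconnections add to the payoffs of one group. The amount is the same for
  both groups, because distances are symmetric and each link is paid once on either side; hence the
  factor 2 in the welfare.\<close>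

definition cross_value :: "'a set set \<Rightarrow> real" where
  "cross_value E = (let m = real (card (interconnections P E)) in
    if m = 0 then 0 else f * (m * y3 \<delta> + real (card (P 1)) * real (card (P 2)) * \<delta>\<^sup>2
      - (real (card (P 1)) - real (card (touched E 1 2)))
        * (real (card (P 2)) - real (card (touched E 2 1))) * \<delta> * y3 \<delta>) - c * m)"

lemma sum_payoff_group:
  assumes "clustered E" "\<alpha> \<noteq> \<beta>"
  shows "(\<Sum>i\<in>P \<alpha>. U E i) = real (card (P \<alpha>)) * (real (card (P \<alpha>)) - 1) * (\<delta> - c) + cross_value E"
proof -
  have "(\<Sum>i\<in>P \<alpha>. U E i) = (\<Sum>i\<in>P \<alpha>. (real (card (P \<alpha>)) - 1) * (\<delta> - c) + f * access E \<alpha> \<beta> i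
    - c * real (card (nbrs E i \<inter> P \<beta>)))"
    by (intro sum.cong refl payoff_clustered assms)
  also have "\<dots> = real (card (P \<alpha>)) * (real (card (P \<alpha>)) - 1) * (\<delta> - c)
      + (f * (\<Sum>i\<in>P \<alpha>. access E \<alpha> \<beta> i) - c * real (card (interconnections P E)))"
    by (simp add: sum.distrib sum_subtractf sum_distrib_left card_interconnections[OF assms(2)])
  also have "f * (\<Sum>i\<in>P \<alpha>. access E \<alpha> \<beta> i) - c * real (card (interconnections P E)) = cross_value E"
    using assms(2)
    by (rule two_cases)
      (simp_all add: cross_value_def Let_def sum_access[OF assms(1)] mult.commute mult.left_commute)
  finally show ?thesis .
qed

lemma welfare_clustered:
  assumes "clustered E"
  shows "W E = base + 2 * cross_value E"
proof -
  have "W E = (\<Sum>i\<in>P 1. U E i) + (\<Sum>i\<in>P 2. U E i)"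
    unfolding welfare_def groups_Un[symmetric]
    by (rule sum.union_disjoint) (use finite_group groups_disjoint in auto)
  then show ?thesis
    by (simp add: sum_payoff_group[OF assms, of 1 2] sum_payoff_group[OF assms, of 2 1] base_def UNIV_2)
qed

subsection \<open>Welfare of matchings\<close>

abbreviation s1 :: nat where "s1 \<equiv> card (P 1)"
abbreviation s2 :: nat where "s2 \<equiv> card (P 2)"
abbreviation q :: nat where "q \<equiv> min s1 s2"

text \<open>The rise of the summed \<open>access\<close> of one group when \<open>k\<close> matched
  pairs become \<open>k + 1\<close>: \<open>y3 \<delta>\<close> for the new link, and
  \<open>\<delta> * y3 \<delta>\<close> for each of the
  \<open>(s1 - k) * (s2 - k) - (s1 - k - 1) * (s2 - k - 1)\<close> pairs that stop being untouched
  at both ends. The first link instead creates all of the cross benefit, \<open>\<delta> * (1 + (s1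
  - 1) * \<delta>) * (1 + (s2 - 1) * \<delta>)\<close>.\<close>

definition surplus :: "nat \<Rightarrow> real" where
  "surplus k = (if k = 0 then y1 \<delta> s1 * y1 \<delta> s2 / \<delta>
     else y3 \<delta> * (1 + (real s1 + real s2 - 2 * real k - 1) * \<delta>))"

definition matching_value :: "nat \<Rightarrow> real" where
  "matching_value m = (\<Sum>k<m. f * surplus k - c)"

lemma y1_gt: "\<delta> < y1 \<delta> (card (P \<alpha>))"
  using card_group[of \<alpha>] delta_pos by (simp add: y1_def)

lemma surplus_strict_antimono_Suc:
  assumes "k < q"
  shows "surplus (Suc k) < surplus k"
proof (cases "k = 0")
  case True
  let ?a = "real s1 - 1" and ?b = "real s2 - 1"
  have ab: "2 \<le> ?a" "2 \<le> ?b" using card_group[of 1] card_group[of 2] by auto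
  \<comment> \<open>In these terms \<open>surplus 0\<close> is
    \<open>\<delta> * (1 + ?a * \<delta>) * (1 + ?b * \<delta>)\<close> and \<open>surplus 1\<close>
    is \<open>y3 \<delta> * (1 + (?a + ?b - 1) * \<delta>)\<close>. From index 1 on,
    \<open>surplus\<close> is linear with negative slope.\<close>
  have "surplus 0 - surplus 1 = \<delta> * (\<delta> * (2 + (?a * ?b + ?a + ?b - 1) * \<delta>))"
    using delta_pos
    by (simp add: surplus_def y1_def y3_def field_simps power2_eq_square)
  moreover have "0 \<le> ?a * ?b" using ab by (intro mult_nonneg_nonneg) auto
  then have "0 \<le> ?a * ?b + ?a + ?b - 1" using ab by linarith
  then have "0 < 2 + (?a * ?b + ?a + ?b - 1) * \<delta>"
    using delta_pos by (intro add_pos_nonneg mult_nonneg_nonneg) simp_all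
  then have "0 < \<delta> * (\<delta> * (2 + (?a * ?b + ?a + ?b - 1) * \<delta>))"
    using delta_pos by simp
  ultimately show ?thesis using True by simp
next
  case False
  then show ?thesis using y3_pos delta_pos by (simp add: surplus_def)
qed

lemma surplus_strict_antimono:
  assumes "k < l" "l \<le> q"
  shows "surplus l < surplus k"
  using assms
proof (induction l)
  case (Suc l)
  then show ?case
    using surplus_strict_antimono_Suc[of l] by (cases "k = l") auto
qed simp

text \<open>\<open>surplus\<close> also counts what the untouched companions of the newly matched
  individual gain by coming nearer to its partner. For \<open>k = 1\<close> a group of at least
  three still leaves such a companion.\<close>

lemma marginal_less_surplus:
  assumes "k = 0 \<or> (k = 1 \<and> 1 < q)"
  shows "marginal (card (P \<alpha>)) k < surplus k"
proof (cases "k = 0")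
  case True
  have pos: "0 < y1 \<delta> (card (P \<gamma>))" for \<gamma> using y1_gt[of \<gamma>] delta_pos by simp
  have "\<delta> * y1 \<delta> (card (P \<gamma>)) < y1 \<delta> (card (P \<gamma>')) * y1 \<delta> (card (P \<gamma>))" for \<gamma> \<gamma>'
    using y1_gt[of \<gamma>'] pos[of \<gamma>] by (intro mult_strict_right_mono) auto
  from this[of 1 2] this[of 2 1]
  have "\<delta> * y1 \<delta> s1 < y1 \<delta> s1 * y1 \<delta> s2" "\<delta> * y1 \<delta> s2 < y1 \<delta> s1 * y1 \<delta> s2"
    by (simp_all add: mult.commute)
  then show ?thesis
    using True delta_pos exhaust_2[of \<alpha>]
    by (auto simp: marginal_def surplus_def field_simps)
next
  case False
  then have "k = 1" using assms by simp
  then have "real (card (P \<alpha>)) - real k < real s1 + real s2 - 2 * real k - 1"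
    using exhaust_2[of \<alpha>] card_group[of 1] card_group[of 2] by auto
  then show ?thesis
    using False y3_pos delta_pos by (simp add: marginal_def surplus_def)
qed

lemma marginal_le_surplus:
  assumes "k < q"
  shows "marginal (card (P \<alpha>)) k \<le> surplus k"
proof (cases "k = 0")
  case True
  then show ?thesis using marginal_less_surplus[of 0 \<alpha>] by simp
next
  case False
  have "real (card (P \<alpha>)) - real k \<le> real s1 + real s2 - 2 * real k - 1"
    using exhaust_2[of \<alpha>] assms by auto
  then show ?thesis
    using False y3_pos delta_pos
    by (auto simp: marginal_def surplus_def intro!: mult_left_mono mult_right_mono)
qed

text \<open>Equality means that no untouched companion is left in either group, so both have exactly
  \<open>k + 1\<close> members. This is the origin of the tie at
  \<open>c / ((1 + \<delta>) * y3 \<delta>)\<close>.\<close>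

lemma marginal_eq_surplus:
  assumes "k < q" "marginal s1 k = surplus k" "marginal s2 k = surplus k"
  shows "s1 = s2 \<and> surplus k = (1 + \<delta>) * y3 \<delta>"
proof -
  have "k \<noteq> 0" using marginal_less_surplus[of 0 1] assms by (metis less_irrefl)
  then have "(real s1 - real k) * \<delta> = (real s1 + real s2 - 2 * real k - 1) * \<delta>"
      "(real s2 - real k) * \<delta> = (real s1 + real s2 - 2 * real k - 1) * \<delta>"
    using assms y3_pos by (auto simp: marginal_def surplus_def)
  then have "real s2 = real k + 1" "real s1 = real k + 1" using delta_pos by auto
  then show ?thesis using \<open>k \<noteq> 0\<close> by (simp add: surplus_def algebra_simps)
qed

text \<open>The induction starts at 1: at 0 the closed form would give every cross pair distance 3,
  although the groups are then disconnected.\<close>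

lemma matching_value_closed:
  assumes "0 < m"
  shows "matching_value m = f * (real m * y3 \<delta> + real s1 * real s2 * \<delta>\<^sup>2
    - (real s1 - real m) * (real s2 - real m) * \<delta> * y3 \<delta>) - c * real m"
  using assms
proof (induction m rule: nat_induct_non_zero)
  case 1
  show ?case
    using delta_pos
    by (simp add: matching_value_def surplus_def y1_def y3_def field_simps power2_eq_square)
next
  case (Suc m)
  have "matching_value (Suc m) = matching_value m + (f * surplus m - c)"
    by (simp add: matching_value_def)
  then show ?case
    using Suc by (simp add: surplus_def algebra_simps)
qed

lemma cross_value_matching:
  assumes "matching E"
  shows "cross_value E = matching_value (card (interconnections P E))"
proof (cases "card (interconnections P E) = 0")
  case True
  then show ?thesis by (simp add: cross_value_def matching_value_def)
next
  case False
  then show ?thesis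
    using matching_card_touched[OF assms, of 1 2] matching_card_touched[OF assms, of 2 1]
    by (simp add: cross_value_def matching_value_closed Let_def)
qed

lemma matching_interconnections_le:
  assumes "matching E"
  shows "card (interconnections P E) \<le> q"
  using matching_card_touched[OF assms, of 1 2] matching_card_touched[OF assms, of 2 1]
    touched_card_le[of E 1 2] touched_card_le[of E 2 1] by simp

text \<open>Given \<open>m\<close> links, the loss from pairs untouched at both ends is smallest
  when the links are spread as a matching. Links beyond \<open>q\<close> cannot reduce it below zero
  and cost more than their own \<open>f * y3 \<delta>\<close>.\<close>

lemma cross_value_le:
  fixes E :: "'a set set"
  assumes "f * y3 \<delta> < c"
  defines "m \<equiv> card (interconnections P E)"
  shows "cross_value E \<le> matching_value (min m q)"
    and "q < m \<Longrightarrow> cross_value E < matching_value (min m q)"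
proof -
  have t: "card (touched E 1 2) \<le> min m s1" "card (touched E 2 1) \<le> min m s2"
    using card_touched_le[of 1 2 E] card_touched_le[of 2 1 E]
      touched_card_le[of E 1 2] touched_card_le[of E 2 1] by (auto simp: m_def)
  have s3: "3 \<le> s1" "3 \<le> s2" using card_group by auto
  have "cross_value E \<le> matching_value (min m q) \<and> (q < m \<longrightarrow> cross_value E < matching_value (min m q))"
  proof (cases "m = 0")
    case True
    then show ?thesis by (simp add: cross_value_def m_def matching_value_def)
  next
    case False
    let ?r = "(real s1 - real (card (touched E 1 2))) * (real s2 - real (card (touched E 2 1)))"
    let ?r' = "(real s1 - real (min m q)) * (real s2 - real (min m q))"
    have "?r' \<le> ?r"
    proof (cases "m \<le> q")
      case True
      then show ?thesis using t by (intro mult_mono) auto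
    next
      case False
      \<comment> \<open>The smaller group is then matched completely, so no pair is untouched at
        both ends.\<close>
      then have "min m q = s1 \<or> min m q = s2" by auto
      then have "?r' = 0" by auto
      also have "0 \<le> ?r" using t by (intro mult_nonneg_nonneg) auto
      finally show ?thesis .
    qed
    then have "f * (?r' * \<delta> * y3 \<delta>) \<le> f * (?r * \<delta> * y3 \<delta>)"
      using f_nonneg delta_pos y3_pos by (intro mult_left_mono mult_right_mono) auto
    moreover have "cross_value E = f * (real s1 * real s2 * \<delta>\<^sup>2) - f * (?r * \<delta> * y3 \<delta>) - (c - f * y3 \<delta>) * real m"
      using False by (simp add: cross_value_def Let_def m_def algebra_simps)
    moreover have "matching_value (min m q) = f * (real s1 * real s2 * \<delta>\<^sup>2) - f * (?r' * \<delta> * y3 \<delta>)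
        - (c - f * y3 \<delta>) * real (min m q)"
    proof -
      have "0 < min m q" using False s3 by auto
      from matching_value_closed[OF this] show ?thesis by (simp add: algebra_simps)
    qed
    moreover have "(c - f * y3 \<delta>) * real (min m q) \<le> (c - f * y3 \<delta>) * real m"
      using assms(1) by (intro mult_left_mono) auto
    moreover have "(c - f * y3 \<delta>) * real (min m q) < (c - f * y3 \<delta>) * real m" if "q < m"
      using assms(1) that by (intro mult_strict_left_mono) auto
    ultimately show ?thesis by linarith
  qed
  then show "cross_value E \<le> matching_value (min m q)"
    and "q < m \<Longrightarrow> cross_value E < matching_value (min m q)" by auto
qed

lemma matching_exists:
  assumes "m \<le> q"
  shows "\<exists>E. clustered E \<and> matching E \<and> card (interconnections P E) = m"
proof -
  obtain A where A: "A \<subseteq> P 1" "card A = m" "finite A"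
    using assms obtain_subset_with_card_n[of m "P 1"] by auto
  obtain B where B: "B \<subseteq> P 2" "card B = m" "finite B"
    using assms obtain_subset_with_card_n[of m "P 2"] by auto
  obtain \<phi> where \<phi>: "bij_betw \<phi> A B"
    using A B finite_same_card_bij by metis
  define E where "E = {{i, j} |i j \<alpha>. i \<in> P \<alpha> \<and> j \<in> P \<alpha> \<and> i \<noteq> j} \<union> {{i, \<phi> i} |i. i \<in> A}"
  have \<phi>B: "\<phi> i \<in> P 2" if "i \<in> A" for i using that \<phi> B by (auto simp: bij_betw_def)
  have ne: "i \<noteq> \<phi> i" if "i \<in> A" for i using cross_neq[of 1 2 i "\<phi> i"] A \<phi>B that by auto
  have cl: "clustered E"
    unfolding clustered_def network_def
  proof (intro conjI subsetI)
    fix e assume "e \<in> E"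
    then consider i j \<alpha> where "e = {i, j}" "i \<in> P \<alpha>" "j \<in> P \<alpha>" "i \<noteq> j" | i where "e = {i, \<phi> i}" "i \<in> A"
      by (auto simp: E_def)
    then show "e \<in> {e. e \<subseteq> V \<and> card e = 2}"
    proof cases
      case 1
      then show ?thesis using group_subset by auto
    next
      case 2
      then have "i \<in> V" "\<phi> i \<in> V" using \<phi>B A group_subset by blast+
      then show ?thesis using 2 ne by simp
    qed
  qed (auto simp: E_def)
  \<comment> \<open>A clique edge never joins disjoint groups, and \<open>\<phi>\<close> maps into
    \<open>P 2\<close>, so a matched edge can only be read with its end in \<open>A\<close>
    first.\<close>
  have cross: "{i, j} \<in> E \<longleftrightarrow> i \<in> A \<and> j = \<phi> i" if "i \<in> P 1" "j \<in> P 2" for i j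
  proof
    assume "{i, j} \<in> E"
    then consider k l \<alpha> where "{i, j} = {k, l}" "k \<in> P \<alpha>" "l \<in> P \<alpha>" | k where "{i, j} = {k, \<phi> k}" "k \<in> A"
      by (auto simp: E_def)
    then show "i \<in> A \<and> j = \<phi> i"
    proof cases
      case 1
      then have "i \<in> P \<alpha>" "j \<in> P \<alpha>" by (auto simp: doubleton_eq_iff)
      then have "(1::2) = 2" using that group_of_eq[of i] group_of_eq[of j] by metis
      then show ?thesis by simp
    next
      case 2
      then have "i = k \<and> j = \<phi> k \<or> i = \<phi> k \<and> j = k" by (auto simp: doubleton_eq_iff)
      then show ?thesis using 2 that cross_neq[of 1 2 i "\<phi> k"] \<phi>B by auto
    qed
  qed (auto simp: E_def)
  have n12: "nbrs E i \<inter> P 2 = (if i \<in> A then {\<phi> i} else {})" if "i \<in> P 1" for i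
    using cross[OF that] \<phi>B by (auto simp: nbrs_def)
  have n21: "nbrs E j \<inter> P 1 \<subseteq> {i \<in> A. \<phi> i = j}" if "j \<in> P 2" for j
    using cross[OF _ that] by (auto simp: nbrs_def insert_commute)
  have "card (nbrs E j \<inter> P 1) \<le> 1" if "j \<in> P 2" for j
  proof -
    have "\<exists>k. {i \<in> A. \<phi> i = j} \<subseteq> {k}" using \<phi> by (auto simp: bij_betw_def inj_on_def)
    then obtain k where "nbrs E j \<inter> P 1 \<subseteq> {k}" using n21[OF \<open>j \<in> P 2\<close>] by blast
    then show ?thesis using card_mono[of "{k}" "nbrs E j \<inter> P 1"] by simp
  qed
  moreover have "card (nbrs E i \<inter> P 2) \<le> 1" if "i \<in> P 1" for i
    using n12[OF that] by auto
  ultimately have "matching E" unfolding matching_def by (auto elim: two_cases)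
  moreover have "nbrs E i \<inter> P 2 \<noteq> {} \<longleftrightarrow> i \<in> A" if "i \<in> P 1" for i
    using n12[OF that] by simp
  then have "touched E 1 2 = A" using A(1) unfolding touched_def by blast
  then have "card (interconnections P E) = m"
    using matching_card_touched[OF \<open>matching E\<close>, of 1 2] A by simp
  ultimately show ?thesis using cl by blast
qed

subsection \<open>Expensive interconnections\<close>

text \<open>The index counts the matched pairs before the link is added, so keeping the links of a
  matching of size \<open>m\<close> is \<open>sustained (m - 1)\<close>.\<close>

definition sustained :: "nat \<Rightarrow> bool" where
  "sustained m \<longleftrightarrow> (\<forall>\<alpha>. c \<le> f * marginal (card (P \<alpha>)) m)"

text \<open>A deviation by addition needs a strict gain at one end and only no loss at the other,
  which is why the two inequalities differ.\<close>

definition blocked :: "nat \<Rightarrow> bool" where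
  "blocked m \<longleftrightarrow> (\<forall>\<alpha> \<beta>. \<alpha> \<noteq> \<beta> \<longrightarrow>
    \<not> (c < f * marginal (card (P \<alpha>)) m \<and> c \<le> f * marginal (card (P \<beta>)) m))"

lemma link_kept:
  assumes "network V E" "{i, j} \<in> E" "c \<le> Fhat P F i j * y3 \<delta>"
  shows "U (E - {{i, j}}) i \<le> U E i"
proof -
  have "insert {i, j} (E - {{i, j}}) = E" using assms by auto
  then show ?thesis
    using payoff_insert_ge[of "E - {{i, j}}" i j] network_edgeD[OF assms(1,2)]
      network_diff[OF assms(1)] assms(3) by simp
qed

lemma touched_diff:
  assumes "matching E" "\<alpha> \<noteq> \<beta>" "i \<in> P \<alpha>" "j \<in> P \<beta>" "{i, j} \<in> E"
  shows "touched (E - {{i, j}}) \<alpha> \<beta> = touched E \<alpha> \<beta> - {i}"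
proof -
  have "card (nbrs E i \<inter> P \<beta>) \<le> 1" using assms by (auto simp: matching_def)
  moreover have "j \<in> nbrs E i \<inter> P \<beta>" using assms by (simp add: nbrs_def)
  ultimately have "nbrs E i \<inter> P \<beta> = {j}"
    using card_le_Suc0_iff_eq[of "nbrs E i \<inter> P \<beta>"] finite_group by auto
  then have "nbrs (E - {{i, j}}) i \<inter> P \<beta> = {}" by (auto simp: nbrs_def)
  moreover have "nbrs (E - {{i, j}}) k = nbrs E k" if "k \<in> P \<alpha>" "k \<noteq> i" for k
    using that cross_neq[OF assms(2) that(1) assms(4)] by (auto simp: nbrs_def doubleton_eq_iff)
  ultimately show ?thesis by (auto simp: touched_def)
qed

lemma edge_touched: "\<lbrakk>i \<in> P \<alpha>; j \<in> P \<beta>; {i, j} \<in> E\<rbrakk> \<Longrightarrow> i \<in> touched E \<alpha> \<beta>"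
  by (auto simp: touched_def nbrs_def)

text \<open>In a matching the deleted link was the only interconnection of both ends. Deletion thus
  reverses an addition between untouched individuals with one matched pair fewer.\<close>

lemma matching_link_payoff:
  assumes "clustered E" "matching E" "\<alpha> \<noteq> \<beta>" "i \<in> P \<alpha>" "j \<in> P \<beta>" "{i, j} \<in> E"
  shows "U E i = U (E - {{i, j}}) i - c
    + f * marginal (card (P \<beta>)) (card (interconnections P E) - 1)"
proof -
  let ?E = "E - {{i, j}}"
  have "touched ?E \<beta> \<alpha> = touched E \<beta> \<alpha> - {j}"
    using touched_diff[of E \<beta> \<alpha> j i] assms by (simp add: insert_commute)
  moreover have "j \<in> touched E \<beta> \<alpha>"
    using edge_touched[of j \<beta> i \<alpha> E] assms by (simp add: insert_commute)
  ultimately have "card (touched ?E \<beta> \<alpha>) = card (interconnections P E) - 1"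
    using matching_card_touched[OF assms(2), of \<beta> \<alpha>] assms(3) finite_touched by simp
  moreover have "i \<notin> touched ?E \<alpha> \<beta>" using touched_diff assms by auto
  moreover have "insert {i, j} ?E = E" using assms by auto
  ultimately show ?thesis
    using payoff_insert_cross[OF clustered_diff[OF assms(1,3-5)] assms(3-5)] by simp
qed

text \<open>Cutting one of two interconnections saves \<open>c\<close> and only moves one partner
  from distance 1 to 2, a loss of \<open>f * y3 \<delta>\<close>.\<close>

lemma stable_matching:
  assumes "f * y3 \<delta> < c" "pairwise_stable V P F \<delta> c E"
  shows "matching E"
  unfolding matching_def
proof (intro allI impI ballI, rule ccontr)
  fix \<alpha> \<beta> i assume ab: "\<alpha> \<noteq> (\<beta>::2)" and i: "i \<in> P \<alpha>" and "\<not> card (nbrs E i \<inter> P \<beta>) \<le> 1"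
  then obtain j k where jk: "j \<in> nbrs E i \<inter> P \<beta>" "k \<in> nbrs E i \<inter> P \<beta>" "j \<noteq> k"
    using card_le_Suc0_iff_eq[of "nbrs E i \<inter> P \<beta>"] finite_group by auto
  then have jP: "j \<in> P \<beta>" by simp
  let ?E = "E - {{i, j}}"
  have E: "{i, j} \<in> E" "insert {i, j} ?E = E" using jk by (auto simp: nbrs_def)
  have "i \<in> touched ?E \<alpha> \<beta>" using jk i by (auto simp: touched_def nbrs_def doubleton_eq_iff)
  then have "U E i = U ?E i - c + f * y3 \<delta>"
    using payoff_insert_cross[OF clustered_diff[OF stable_clustered[OF assms(2)] ab i jP] ab i jP] E
    by simp
  moreover have "U ?E i \<le> U E i" using assms(2) E by (auto simp: pairwise_stable_def)
  ultimately show False using assms(1) by simp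
qed

lemma cross_groups:
  assumes "clustered E" "i \<in> V" "j \<in> V" "i \<noteq> j" "{i, j} \<notin> E"
  obtains \<alpha> \<beta> where "\<alpha> \<noteq> \<beta>" "i \<in> P \<alpha>" "j \<in> P \<beta>"
  using assms in_group clustered_edge by metis

lemma untouched_not_edge:
  "\<lbrakk>i \<in> P \<alpha>; j \<in> P \<beta>; i \<notin> touched E \<alpha> \<beta>\<rbrakk> \<Longrightarrow> {i, j} \<notin> E"
  using edge_touched by blast

lemma stable_add_blocked:
  assumes "pairwise_stable V P F \<delta> c E" "\<alpha> \<noteq> \<beta>" "i \<in> P \<alpha>" "j \<in> P \<beta>"
    "i \<notin> touched E \<alpha> \<beta>" "j \<notin> touched E \<beta> \<alpha>"
  shows "\<not> (c < f * marginal (card (P \<beta>)) (card (touched E \<beta> \<alpha>)) \<and>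
    c \<le> f * marginal (card (P \<alpha>)) (card (touched E \<alpha> \<beta>)))"
proof -
  note cl = stable_clustered[OF assms(1)]
  have notin: "{i, j} \<notin> E" using assms untouched_not_edge by blast
  have "i \<in> V" "j \<in> V" "i \<noteq> j" using assms group_subset cross_neq[OF assms(2-4)] by auto
  then have "U E i < U (insert {i, j} E) i \<longrightarrow> U (insert {i, j} E) j < U E j"
    using assms(1) notin by (auto simp: pairwise_stable_def)
  moreover have "U (insert {i, j} E) i = U E i - c + f * marginal (card (P \<beta>)) (card (touched E \<beta> \<alpha>))"
    using payoff_insert_cross[OF cl assms(2-4) notin] assms by simp
  moreover have "U (insert {i, j} E) j = U E j - c + f * marginal (card (P \<alpha>)) (card (touched E \<alpha> \<beta>))"
    using payoff_insert_cross[OF cl assms(2)[symmetric] assms(4,3)] notin assms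
    by (simp add: insert_commute)
  ultimately show ?thesis by auto
qed

text \<open>Links inside groups are safe, every deletion of an interconnection is the same by
  symmetry, and an addition can only succeed between two untouched individuals, which exist exactly
  when \<open>m < q\<close>.\<close>

lemma matching_stable_iff:
  assumes lt: "f * y3 \<delta> < c" and cl: "clustered E" and M: "matching E"
  defines "m \<equiv> card (interconnections P E)"
  shows "pairwise_stable V P F \<delta> c E \<longleftrightarrow>
    (0 < m \<longrightarrow> sustained (m - 1)) \<and> (m < q \<longrightarrow> blocked m)"
proof (intro iffI conjI impI)
  assume st: "pairwise_stable V P F \<delta> c E" and "0 < m"
  then obtain i j where ij: "i \<in> P 1" "j \<in> P 2" "{i, j} \<in> E"
    unfolding m_def card_gt_0_iff by (auto simp: interconnections_def)
  then have "U (E - {{i, j}}) i \<le> U E i" "U (E - {{i, j}}) j \<le> U E j"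
    using st by (auto simp: pairwise_stable_def)
  then have "c \<le> f * marginal s1 (m - 1)" "c \<le> f * marginal s2 (m - 1)"
    using matching_link_payoff[OF cl M, of 1 2 i j] matching_link_payoff[OF cl M, of 2 1 j i] ij
    by (auto simp: m_def insert_commute)
  then show "sustained (m - 1)" by (simp add: sustained_def forall_2)
next
  assume st: "pairwise_stable V P F \<delta> c E" and "m < q"
  have t: "card (touched E \<alpha> \<beta>) = m" if "\<alpha> \<noteq> \<beta>" for \<alpha> \<beta>
    using matching_card_touched[OF M that] by (simp add: m_def)
  show "blocked m"
    unfolding blocked_def
  proof (intro allI impI)
    fix \<alpha> \<beta> :: 2 assume ab: "\<alpha> \<noteq> \<beta>"
    have q: "m < card (P \<gamma>)" for \<gamma> using \<open>m < q\<close> exhaust_2[of \<gamma>] by auto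
    have "touched E \<alpha> \<beta> \<noteq> P \<alpha>" using t[OF ab] q[of \<alpha>] by auto
    moreover have "touched E \<beta> \<alpha> \<noteq> P \<beta>" using t[OF ab[symmetric]] q[of \<beta>] by auto
    ultimately obtain i j where "i \<in> P \<alpha>" "i \<notin> touched E \<alpha> \<beta>" "j \<in> P \<beta>" "j \<notin> touched E \<beta> \<alpha>"
      using touched_subset by blast
    then show "\<not> (c < f * marginal (card (P \<alpha>)) m \<and> c \<le> f * marginal (card (P \<beta>)) m)"
      using stable_add_blocked[OF st ab[symmetric], of j i] t[OF ab] t[OF ab[symmetric]] by simp
  qed
next
  assume R: "(0 < m \<longrightarrow> sustained (m - 1)) \<and> (m < q \<longrightarrow> blocked m)"
  have net: "network V E" using cl by (rule clustered_network)
  have keep: "U (E - {{i, j}}) i \<le> U E i" if ij: "{i, j} \<in> E" for i j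
  proof -
    have V: "i \<in> V" "j \<in> V" "i \<noteq> j" using network_edgeD[OF net ij] by auto
    then obtain \<alpha> \<beta> where ab: "i \<in> P \<alpha>" "j \<in> P \<beta>" using in_group by blast
    show ?thesis
    proof (cases "\<alpha> = \<beta>")
      case True
      then show ?thesis
        using link_kept[OF net ij] same_group_gain[of i \<alpha> j] ab V by simp
    next
      case False
      have "0 < m"
        using interconnections_eq_0_iff[OF False, of E] edge_touched[OF ab ij] finite_touched
        by (auto simp: m_def card_gt_0_iff)
      then have "c \<le> f * marginal (card (P \<beta>)) (m - 1)" using R by (simp add: sustained_def)
      then show ?thesis using matching_link_payoff[OF cl M False ab ij] by (simp add: m_def)
    qed
  qed
  have add: "U (insert {i, j} E) j < U E j"
    if ij: "i \<in> V" "j \<in> V" "i \<noteq> j" "{i, j} \<notin> E" and gain: "U E i < U (insert {i, j} E) i" for i j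
  proof -
    obtain \<alpha> \<beta> where ab: "\<alpha> \<noteq> \<beta>" "i \<in> P \<alpha>" "j \<in> P \<beta>" using cross_groups[OF cl ij] .
    have Ui: "U (insert {i, j} E) i = U E i - c +
        f * (if i \<in> touched E \<alpha> \<beta> then y3 \<delta> else marginal (card (P \<beta>)) m)"
      using payoff_insert_cross[OF cl ab ij(4)] matching_card_touched[OF M, of \<beta> \<alpha>] ab
      by (simp add: m_def)
    have Uj: "U (insert {i, j} E) j = U E j - c +
        f * (if j \<in> touched E \<beta> \<alpha> then y3 \<delta> else marginal (card (P \<alpha>)) m)"
      using payoff_insert_cross[OF cl ab(1)[symmetric] ab(3,2)] ij(4) matching_card_touched[OF M, of \<alpha> \<beta>] ab
      by (simp add: m_def insert_commute)
    \<comment> \<open>A touched end would change its payoff by \<open>f * y3 \<delta> - c\<close>,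
      which is negative.\<close>
    have ni: "i \<notin> touched E \<alpha> \<beta>" using Ui gain lt by (auto split: if_splits)
    then have gi: "c < f * marginal (card (P \<beta>)) m" using Ui gain by simp
    show ?thesis
    proof (cases "j \<in> touched E \<beta> \<alpha>")
      case True
      then show ?thesis using Uj lt by simp
    next
      case False
      have "touched E \<alpha> \<beta> \<subset> P \<alpha>" "touched E \<beta> \<alpha> \<subset> P \<beta>"
        using touched_subset ab ni False by blast+
      then have "m < card (P \<alpha>)" "m < card (P \<beta>)"
        using psubset_card_mono[OF finite_group] matching_card_touched[OF M] ab(1)
        by (metis m_def)+
      then have "m < q" using ab(1) by (auto elim: two_cases)
      then have "blocked m" using R by simp
      then have "\<not> (c \<le> f * marginal (card (P \<alpha>)) m)"
        using gi ab(1) unfolding blocked_def by metis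
      then show ?thesis using Uj False by simp
    qed
  qed
  show "pairwise_stable V P F \<delta> c E"
    unfolding pairwise_stable_def
  proof (intro conjI allI impI ballI)
    fix i j assume ij: "{i, j} \<in> E"
    show "U (E - {{i, j}}) i \<le> U E i" using keep[OF ij] .
    show "U (E - {{i, j}}) j \<le> U E j" using keep[of j i] ij by (simp add: insert_commute)
  qed (use net add in auto)
qed

text \<open>Every size up to \<open>q\<close> is realized by a matching, so
  \<open>cross_value E\<close> dominates all matching values, and the upper bound then pins it down.
  \<open>E\<close> itself need not be a matching: if \<open>q\<close> links touch all of the smaller
  group, they may share ends in the larger one at no loss.\<close>

lemma efficient_size:
  assumes "f * y3 \<delta> < c" "efficient V P F \<delta> c E"
  shows "card (interconnections P E) \<le> q"
    and "k \<le> q \<Longrightarrow> matching_value k \<le> matching_value (card (interconnections P E))"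
    and "W E = base + 2 * matching_value (card (interconnections P E))"
proof -
  let ?m = "card (interconnections P E)"
  have WE: "W E = base + 2 * cross_value E"
    using efficient_clustered[OF assms(2)] by (rule welfare_clustered)
  have best: "matching_value k \<le> cross_value E" if k: "k \<le> q" for k
  proof -
    obtain E' where E': "clustered E'" "matching E'" "card (interconnections P E') = k"
      using matching_exists[OF k] by blast
    then have "W E' = base + 2 * matching_value k"
      using welfare_clustered cross_value_matching by metis
    moreover have "W E' \<le> W E"
      using assms(2) clustered_network[OF E'(1)] by (simp add: efficient_def)
    ultimately show ?thesis using WE by simp
  qed
  show m: "?m \<le> q"
    using cross_value_le(2)[OF assms(1), of E] best[of "min ?m q"] by (cases "q < ?m") auto
  then have "cross_value E = matching_value ?m"
    using cross_value_le(1)[OF assms(1), of E] best[of ?m] by (simp add: min_absorb1)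
  then show "W E = base + 2 * matching_value ?m"
    and "k \<le> q \<Longrightarrow> matching_value k \<le> matching_value ?m"
    using WE best by auto
qed

lemma matching_efficient:
  assumes "f * y3 \<delta> < c" "clustered E" "matching E"
    and best: "\<And>k. k \<le> q \<Longrightarrow> matching_value k \<le> matching_value (card (interconnections P E))"
  shows "efficient V P F \<delta> c E"
proof -
  obtain E' where E': "efficient V P F \<delta> c E'" using efficient_exists[OF finite_V] by blast
  have "W E' \<le> W E"
    using efficient_size[OF assms(1) E'] best welfare_clustered[OF assms(2)] cross_value_matching[OF assms(3)]
    by simp
  then show ?thesis
    using E' clustered_network[OF assms(2)] unfolding efficient_def by (meson order_trans)
qed

subsection \<open>Cheap interconnections\<close>

lemma Fhat_y3_cases:
  assumes "i \<in> V" "j \<in> V" "i \<noteq> j"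
  obtains "Fhat P F i j = 1" | "Fhat P F i j = f"
  using assms in_group Fhat_same Fhat_cross by metis

lemma cost_le_Fhat:
  assumes "c \<le> f * y3 \<delta>" "i \<in> V" "j \<in> V" "i \<noteq> j"
  shows "c \<le> Fhat P F i j * y3 \<delta>"
  using assms(2-4) by (rule Fhat_y3_cases) (use assms(1) cost_less in auto)

lemma cost_less_Fhat:
  assumes "c < f * y3 \<delta>" "i \<in> V" "j \<in> V" "i \<noteq> j"
  shows "c < Fhat P F i j * y3 \<delta>"
  using assms(2-4) by (rule Fhat_y3_cases) (use assms(1) cost_less in auto)

abbreviation complete_network :: "'a set set" where "complete_network \<equiv> {e. e \<subseteq> V \<and> card e = 2}"

lemma complete_eqI:
  assumes "network V E" "\<And>i j. \<lbrakk>i \<in> V; j \<in> V; i \<noteq> j\<rbrakk> \<Longrightarrow> {i, j} \<in> E"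
  shows "E = complete_network"
  using assms by (auto simp: network_def card_2_iff)

lemma complete_edge: "\<lbrakk>i \<in> V; j \<in> V; i \<noteq> j\<rbrakk> \<Longrightarrow> {i, j} \<in> complete_network"
  by auto

text \<open>Every link pays, so an efficient network must be complete; as some network is efficient,
  the complete one is.\<close>

lemma efficient_iff_complete:
  assumes "c < f * y3 \<delta>"
  shows "efficient V P F \<delta> c E \<longleftrightarrow> E = complete_network"
proof -
  have *: "E = complete_network" if "efficient V P F \<delta> c E" for E
    using that efficient_edge[OF that] cost_less_Fhat[OF assms]
    by (intro complete_eqI) (auto simp: efficient_def)
  then show ?thesis using efficient_exists[OF finite_V, of P F \<delta> c] by blast
qed

lemma stable_iff_complete:
  assumes "c < f * y3 \<delta>"
  shows "pairwise_stable V P F \<delta> c E \<longleftrightarrow> E = complete_network"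
proof
  assume st: "pairwise_stable V P F \<delta> c E"
  then show "E = complete_network"
    using stable_edge[OF st] cost_less_Fhat[OF assms]
    by (intro complete_eqI) (auto simp: pairwise_stable_def)
next
  have net: "network V complete_network" by (simp add: network_def)
  have keep: "U (complete_network - {{i, j}}) i \<le> U complete_network i" if "{i, j} \<in> complete_network" for i j
    using link_kept[OF net that] cost_less_Fhat[OF assms] network_edgeD[OF net that] by (simp add: less_imp_le)
  assume "E = complete_network"
  moreover have "pairwise_stable V P F \<delta> c complete_network"
    unfolding pairwise_stable_def
  proof (intro conjI allI impI ballI)
    fix i j assume ij: "{i, j} \<in> complete_network"
    show "U (complete_network - {{i, j}}) i \<le> U complete_network i" using keep[OF ij] .
    show "U (complete_network - {{i, j}}) j \<le> U complete_network j"
      using keep[of j i] ij by (simp add: insert_commute)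
  qed (use net complete_edge in blast)+
  ultimately show "pairwise_stable V P F \<delta> c E" by simp
qed

text \<open>No cross pair is untouched at both ends, so no cross distance exceeds 2. In the
  break-even case \<open>f = 0\<close> means that interconnections are free and worthless, and every
  choice of them is equally good.\<close>

definition saturated :: "'a set set \<Rightarrow> bool" where
  "saturated E \<longleftrightarrow> f = 0 \<or> touched E 1 2 = P 1 \<or> touched E 2 1 = P 2"

text \<open>Each link exactly pays for its own \<open>y3 \<delta>\<close>, and what remains is the
  term of all pairs at distance 2 minus the loss from pairs untouched at both ends.\<close>

lemma cross_value_break_even:
  assumes "c = f * y3 \<delta>"
  shows "cross_value E \<le> f * (real s1 * real s2 * \<delta>\<^sup>2)"
    and "cross_value E = f * (real s1 * real s2 * \<delta>\<^sup>2) \<longleftrightarrow> saturated E"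
proof -
  let ?a = "card (touched E 1 2)" and ?b = "card (touched E 2 1)"
  let ?r = "(real s1 - real ?a) * (real s2 - real ?b)"
  have s3: "3 \<le> s1" "3 \<le> s2" using card_group by auto
  have full: "touched E 1 2 = P 1 \<longleftrightarrow> ?a = s1" "touched E 2 1 = P 2 \<longleftrightarrow> ?b = s2"
    using card_subset_eq[OF finite_group touched_subset] by auto
  have "cross_value E \<le> f * (real s1 * real s2 * \<delta>\<^sup>2) \<and>
    (cross_value E = f * (real s1 * real s2 * \<delta>\<^sup>2) \<longleftrightarrow> saturated E)"
  proof (cases "card (interconnections P E) = 0")
    case True
    then have "?a = 0" "?b = 0"
      using interconnections_eq_0_iff[of 1 2 E] interconnections_eq_0_iff[of 2 1 E] by auto
    then have "saturated E \<longleftrightarrow> f = 0" using full s3 unfolding saturated_def by auto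
    moreover have "real s1 * real s2 * \<delta>\<^sup>2 > 0" using s3 delta_pos by (intro mult_pos_pos) auto
    ultimately show ?thesis using True f_nonneg by (auto simp: cross_value_def Let_def)
  next
    case False
    then have "cross_value E = f * (real s1 * real s2 * \<delta>\<^sup>2) - f * (?r * (\<delta> * y3 \<delta>))
        - (c - f * y3 \<delta>) * real (card (interconnections P E))"
      by (simp add: cross_value_def Let_def algebra_simps)
    then have "cross_value E = f * (real s1 * real s2 * \<delta>\<^sup>2) - f * (?r * (\<delta> * y3 \<delta>))"
      using assms by simp
    moreover have "0 \<le> ?r"
      using touched_card_le[of E] by (intro mult_nonneg_nonneg) auto
    moreover have "?r = 0 \<longleftrightarrow> ?a = s1 \<or> ?b = s2" by auto
    moreover have "0 < \<delta> * y3 \<delta>" using delta_pos y3_pos by simp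
    ultimately show ?thesis
      using full f_nonneg unfolding saturated_def by auto
  qed
  then show "cross_value E \<le> f * (real s1 * real s2 * \<delta>\<^sup>2)"
    and "cross_value E = f * (real s1 * real s2 * \<delta>\<^sup>2) \<longleftrightarrow> saturated E" by auto
qed

lemma efficient_iff_saturated:
  assumes "c = f * y3 \<delta>"
  shows "efficient V P F \<delta> c E \<longleftrightarrow> clustered E \<and> saturated E"
proof -
  let ?M = "base + 2 * (f * (real s1 * real s2 * \<delta>\<^sup>2))"
  obtain E' where E': "clustered E'" "matching E'" "card (interconnections P E') = q"
    using matching_exists[of q] by auto
  then have "card (touched E' 1 2) = q" "card (touched E' 2 1) = q"
    using matching_card_touched by auto
  \<comment> \<open>A matching of size \<open>q\<close> exhausts the smaller group, which provides a
    network attaining the bound.\<close>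
  then have "card (touched E' 1 2) = s1 \<or> card (touched E' 2 1) = s2" by linarith
  then have "saturated E'"
    using card_subset_eq[OF finite_group touched_subset] unfolding saturated_def by blast
  then have W': "W E' = ?M" using cross_value_break_even[OF assms] welfare_clustered[OF E'(1)] by simp
  have W_le: "W E \<le> ?M" "W E = ?M \<longleftrightarrow> saturated E" if "clustered E" for E
    using cross_value_break_even[OF assms, of E] welfare_clustered[OF that] by auto
  have max: "W E = ?M" if "efficient V P F \<delta> c E" for E
    using that W' W_le efficient_clustered[OF that] clustered_network[OF E'(1)]
    unfolding efficient_def by (metis order_antisym)
  show ?thesis
  proof
    assume "efficient V P F \<delta> c E"
    then show "clustered E \<and> saturated E" using max W_le efficient_clustered by blast
  next
    assume E: "clustered E \<and> saturated E"
    obtain E0 where E0: "efficient V P F \<delta> c E0" using efficient_exists[OF finite_V] by blast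
    have "W E = W E0" using E W_le(2) max[OF E0] by simp
    then show "efficient V P F \<delta> c E"
      using E0 E clustered_network by (simp add: efficient_def)
  qed
qed

lemma marginal_gt_y3:
  assumes "t < card (P \<alpha>)"
  shows "y3 \<delta> < marginal (card (P \<alpha>)) t"
proof (cases "t = 0")
  case True
  have "0 < \<delta>\<^sup>2" using delta_pos by simp
  then have "y3 \<delta> < y1 \<delta> (card (P \<alpha>))" using y1_gt[of \<alpha>] unfolding y3_def by linarith
  then show ?thesis using True by (simp add: marginal_def)
next
  case False
  then show ?thesis
    using assms delta_pos y3_pos mult_strict_left_mono[of 1 "1 + (real (card (P \<alpha>)) - real t) * \<delta>" "y3 \<delta>"]
    by (simp add: marginal_def)
qed

text \<open>Two untouched individuals would both gain strictly by linking. Once no such pair is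
  left, each further interconnection earns exactly its cost, so nobody gains strictly.\<close>

lemma stable_iff_saturated:
  assumes eq: "c = f * y3 \<delta>"
  shows "pairwise_stable V P F \<delta> c E \<longleftrightarrow> clustered E \<and> saturated E"
proof
  assume st: "pairwise_stable V P F \<delta> c E"
  have "saturated E"
  proof (rule ccontr)
    assume "\<not> saturated E"
    then have f: "0 < f" and n: "touched E 1 2 \<subset> P 1" "touched E 2 1 \<subset> P 2"
      using f_nonneg touched_subset unfolding saturated_def by auto
    then obtain i j where ij: "i \<in> P 1" "i \<notin> touched E 1 2" "j \<in> P 2" "j \<notin> touched E 2 1"
      by blast
    have "card (touched E 1 2) < s1" "card (touched E 2 1) < s2"
      using n psubset_card_mono[OF finite_group] by auto
    then have "c < f * marginal s1 (card (touched E 1 2))" "c < f * marginal s2 (card (touched E 2 1))"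
      using marginal_gt_y3 f eq by auto
    then show False using stable_add_blocked[OF st, of 1 2 i j] ij by simp
  qed
  then show "clustered E \<and> saturated E" using stable_clustered[OF st] by simp
next
  assume E: "clustered E \<and> saturated E"
  then have cl: "clustered E" and net: "network V E" by (auto simp: clustered_network)
  have keep: "U (E - {{i, j}}) i \<le> U E i" if "{i, j} \<in> E" for i j
    using link_kept[OF net that] cost_le_Fhat[of i j] eq network_edgeD[OF net that] by simp
  have add: "U (insert {i, j} E) i = U E i" if ij: "i \<in> V" "j \<in> V" "i \<noteq> j" "{i, j} \<notin> E" for i j
  proof -
    obtain \<alpha> \<beta> where ab: "\<alpha> \<noteq> \<beta>" "i \<in> P \<alpha>" "j \<in> P \<beta>" using cross_groups[OF cl ij] .
    have "f = 0 \<or> touched E \<alpha> \<beta> = P \<alpha> \<or> touched E \<beta> \<alpha> = P \<beta>"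
      using E ab(1) by (auto simp: saturated_def elim: two_cases)
    \<comment> \<open>An untouched \<open>i\<close> facing a completely touched group is at distance
      2 from all of it, so it gains no more than a touched one.\<close>
    moreover have "marginal (card (P \<beta>)) (card (P \<beta>)) = y3 \<delta>"
      using card_group[of \<beta>] by (simp add: marginal_def)
    ultimately show ?thesis
      using payoff_insert_cross[OF cl ab ij(4)] ab(2) eq by auto
  qed
  show "pairwise_stable V P F \<delta> c E"
    unfolding pairwise_stable_def
  proof (intro conjI allI impI ballI)
    fix i j assume ij: "{i, j} \<in> E"
    show "U (E - {{i, j}}) i \<le> U E i" using keep[OF ij] .
    show "U (E - {{i, j}}) j \<le> U E j" using keep[of j i] ij by (simp add: insert_commute)
  qed (use net add in auto)
qed

lemma efficient_iff_stable:
  assumes "c \<le> f * y3 \<delta>"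
  shows "efficient V P F \<delta> c E \<longleftrightarrow> pairwise_stable V P F \<delta> c E"
  using assms efficient_iff_complete stable_iff_complete efficient_iff_saturated stable_iff_saturated
  by (cases "c = f * y3 \<delta>") auto

subsection \<open>Comparison\<close>

lemma matching_value_split:
  assumes "k \<le> l"
  shows "matching_value l = matching_value k + (\<Sum>i=k..<l. f * surplus i - c)"
  using assms sum.atLeastLessThan_concat[of 0 k l "\<lambda>i. f * surplus i - c"]
  by (simp add: matching_value_def lessThan_atLeast0)

lemma matching_value_mono:
  assumes "k \<le> l" "\<And>i. \<lbrakk>k \<le> i; i < l\<rbrakk> \<Longrightarrow> c \<le> f * surplus i"
  shows "matching_value k \<le> matching_value l"
  using assms by (auto simp: matching_value_split[OF assms(1)] intro!: sum_nonneg)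

lemma matching_value_strict_mono:
  assumes "k < l" "\<And>i. \<lbrakk>k \<le> i; i < l\<rbrakk> \<Longrightarrow> c < f * surplus i"
  shows "matching_value k < matching_value l"
  using assms by (auto simp: matching_value_split[of k l] intro!: sum_pos)

lemma matching_value_antimono:
  assumes "k \<le> l" "\<And>i. \<lbrakk>k \<le> i; i < l\<rbrakk> \<Longrightarrow> f * surplus i \<le> c"
  shows "matching_value l \<le> matching_value k"
  using assms by (auto simp: matching_value_split[OF assms(1)] intro!: sum_nonpos)

lemma matching_value_strict_antimono:
  assumes "k < l" "\<And>i. \<lbrakk>k \<le> i; i < l\<rbrakk> \<Longrightarrow> f * surplus i < c"
  shows "matching_value l < matching_value k"
  using assms sum_pos[of "{k..<l}" "\<lambda>i. - (f * surplus i - c)"]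
  by (simp add: matching_value_split[of k l] sum_negf sum_subtractf)

lemma sustained_surplus:
  assumes "sustained k" "k < q"
  shows "c \<le> f * surplus k"
proof -
  have "f * marginal s1 k \<le> f * surplus k"
    using marginal_le_surplus[OF assms(2)] f_nonneg by (rule mult_left_mono)
  then show ?thesis using assms(1) unfolding sustained_def by (meson order_trans)
qed

lemma surplus_antimono:
  assumes "k \<le> l" "l \<le> q"
  shows "f * surplus l \<le> f * surplus k"
  using surplus_strict_antimono[of k l] assms f_nonneg
  by (cases "k = l") (auto intro!: mult_left_mono)

end

section \<open>Sizes of efficient and stable networks when an interconnection costs more than its
  direct benefit\<close>

locale costly_links = two_groups +
  assumes costly: "f * y3 \<delta> < c"
begin

lemma cost_pos: "0 < c"
  using costly mult_nonneg_nonneg[OF f_nonneg less_imp_le[OF y3_pos]] by simp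

lemma f_pos:
  assumes "c \<le> f * x"
  shows "0 < f"
  using assms cost_pos f_nonneg by (cases "f = 0") auto

lemma stable_size:
  assumes "pairwise_stable V P F \<delta> c E"
  defines "m \<equiv> card (interconnections P E)"
  shows "m \<le> q" "0 < m \<Longrightarrow> sustained (m - 1)" "m < q \<Longrightarrow> blocked m"
    and "W E = base + 2 * matching_value m"
proof -
  note M = stable_matching[OF costly assms(1)] and cl = stable_clustered[OF assms(1)]
  show "m \<le> q" using matching_interconnections_le[OF M] by (simp add: m_def)
  show "0 < m \<Longrightarrow> sustained (m - 1)" "m < q \<Longrightarrow> blocked m"
    using matching_stable_iff[OF costly cl M] assms by auto
  show "W E = base + 2 * matching_value m"
    using welfare_clustered[OF cl] cross_value_matching[OF M] by (simp add: m_def)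
qed

lemma stable_efficient:
  assumes "pairwise_stable V P F \<delta> c E"
    and "\<And>k. k \<le> q \<Longrightarrow> matching_value k \<le> matching_value (card (interconnections P E))"
  shows "efficient V P F \<delta> c E"
  using matching_efficient[OF costly stable_clustered stable_matching[OF costly]] assms by blast

lemma stable_surplus:
  assumes "pairwise_stable V P F \<delta> c E" "i < card (interconnections P E)"
  shows "c \<le> f * surplus i"
proof -
  let ?m = "card (interconnections P E)"
  have "sustained (?m - 1)" "?m - 1 < q" using stable_size[OF assms(1)] assms(2) by auto
  then have "c \<le> f * surplus (?m - 1)" by (rule sustained_surplus)
  also have "\<dots> \<le> f * surplus i"
    using assms(2) \<open>?m - 1 < q\<close> by (intro surplus_antimono) auto
  finally show ?thesis .
qed

text \<open>If the stable size \<open>?m\<close> were larger, its last link being sustained would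
  make every earlier step strictly raise the welfare. The efficient size is then
  \<open>?m - 1\<close> and the last step is a tie, which squeezes both marginals onto
  \<open>surplus\<close> and forces the excluded case.\<close>

lemma efficient_ge_stable:
  assumes eff: "efficient V P F \<delta> c E" and st: "pairwise_stable V P F \<delta> c E'"
    and tie: "\<not> (s1 = s2 \<and> f = c / ((1 + \<delta>) * y3 \<delta>))"
  shows "card (interconnections P E') \<le> card (interconnections P E)"
proof (rule ccontr)
  let ?e = "card (interconnections P E)" and ?m = "card (interconnections P E')"
  assume "\<not> ?m \<le> ?e"
  then have em: "?e < ?m" by simp
  have mq: "?m - 1 < q" and sus: "sustained (?m - 1)" using stable_size[OF st] em by auto
  have f: "0 < f" using sus f_pos unfolding sustained_def by blast
  have le: "c \<le> f * surplus (?m - 1)" using sus mq by (rule sustained_surplus)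
  have best: "matching_value k \<le> matching_value ?e" if "k \<le> q" for k
    using efficient_size(2)[OF costly eff that] .
  have step: "matching_value ?m = matching_value (?m - 1) + (f * surplus (?m - 1) - c)"
    using em matching_value_split[of "?m - 1" ?m] by (cases ?m) auto
  have e: "?e = ?m - 1"
  proof (rule ccontr)
    assume "?e \<noteq> ?m - 1"
    then have "matching_value ?e < matching_value (?m - 1)"
    proof (intro matching_value_strict_mono)
      fix i assume "i < ?m - 1"
      then have "f * surplus (?m - 1) < f * surplus i"
        using f mq surplus_strict_antimono by simp
      then show "c < f * surplus i" using le by simp
    qed (use em in auto)
    then show False using best[of "?m - 1"] mq by simp
  qed
  then have "f * surplus (?m - 1) = c"
    using best[OF stable_size(1)[OF st]] step le by simp
  \<comment> \<open>Squeezed between \<open>c\<close>, by \<open>sustained\<close>, and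
    \<open>f * surplus (?m - 1) = c\<close>.\<close>
  moreover have "f * marginal (card (P \<alpha>)) (?m - 1) = c" for \<alpha>
  proof (rule antisym)
    show "f * marginal (card (P \<alpha>)) (?m - 1) \<le> c"
      using mult_left_mono[OF marginal_le_surplus[OF mq, of \<alpha>] f_nonneg] calculation by simp
  qed (use sus in \<open>simp add: sustained_def\<close>)
  ultimately have "marginal (card (P \<alpha>)) (?m - 1) = surplus (?m - 1)" for \<alpha>
    using f by (metis mult_left_cancel less_irrefl)
  then have "s1 = s2" and "surplus (?m - 1) = (1 + \<delta>) * y3 \<delta>"
    using marginal_eq_surplus[OF mq] by auto
  moreover have "(1 + \<delta>) * y3 \<delta> \<noteq> 0" using delta_pos y3_pos by simp
  ultimately show False
    using tie \<open>f * surplus (?m - 1) = c\<close> by (simp add: field_simps)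
qed

text \<open>A successful addition gives one end a strict gain, and this strictness passes on to the
  welfare; \<open>sustained\<close> alone would only give a weak inequality.\<close>

lemma not_blocked_surplus:
  assumes "\<not> blocked k" "k < q"
  shows "sustained k" "c < f * surplus k"
proof -
  obtain \<alpha> \<beta> where ab: "\<alpha> \<noteq> \<beta>" "c < f * marginal (card (P \<alpha>)) k" "c \<le> f * marginal (card (P \<beta>)) k"
    using assms(1) by (auto simp: blocked_def)
  have "f * marginal (card (P \<alpha>)) k \<le> f * surplus k"
    using marginal_le_surplus[OF assms(2)] f_nonneg by (rule mult_left_mono)
  then show "c < f * surplus k" using ab by simp
  show "sustained k"
    using ab(1) by (rule two_cases) (use ab in \<open>auto simp: sustained_def forall_2\<close>)
qed

text \<open>The witness is the matching at which adding links first stops, or size \<open>q\<close>.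
  All steps before it strictly raise the welfare, so no efficient network is smaller, whatever ties
  occur later.\<close>

lemma stable_le_efficient:
  shows "\<exists>E'. pairwise_stable V P F \<delta> c E' \<and>
    (\<forall>E. efficient V P F \<delta> c E \<longrightarrow> card (interconnections P E') \<le> card (interconnections P E))"
proof -
  define m where "m = (LEAST k. k = q \<or> blocked k)"
  have m: "m = q \<or> blocked m" unfolding m_def by (rule LeastI[of _ q]) simp
  have mq: "m \<le> q" unfolding m_def by (rule Least_le) simp
  have less: "sustained k" "c < f * surplus k" if "k < m" for k
  proof -
    have "\<not> blocked k" using not_less_Least[of k "\<lambda>k. k = q \<or> blocked k"] that by (simp add: m_def)
    then show "sustained k" "c < f * surplus k"
      using not_blocked_surplus that mq by auto
  qed
  obtain E' where E': "clustered E'" "matching E'" "card (interconnections P E') = m"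
    using matching_exists[OF mq] by blast
  have "pairwise_stable V P F \<delta> c E'"
    using matching_stable_iff[OF costly E'(1,2)] E'(3) m less(1)[of "m - 1"] by auto
  moreover have "m \<le> card (interconnections P E)" if "efficient V P F \<delta> c E" for E
  proof (rule ccontr)
    assume "\<not> m \<le> card (interconnections P E)"
    then have "matching_value (card (interconnections P E)) < matching_value m"
      using less(2) by (intro matching_value_strict_mono) auto
    then show False using efficient_size(2)[OF costly that mq] by simp
  qed
  ultimately show ?thesis using E'(3) by blast
qed

text \<open>If an efficient network is smaller than the stable one, the steps in between do not
  lower the welfare, so the stable network is efficient and serves as its own witness.\<close>

lemma efficient_ge_some_stable:
  assumes st: "pairwise_stable V P F \<delta> c E'"
  shows "\<exists>E. efficient V P F \<delta> c E \<and> card (interconnections P E') \<le> card (interconnections P E)"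
proof -
  obtain E where E: "efficient V P F \<delta> c E" using efficient_exists[OF finite_V] by blast
  let ?e = "card (interconnections P E)" and ?m = "card (interconnections P E')"
  show ?thesis
  proof (cases "?m \<le> ?e")
    case False
    then have "matching_value ?e \<le> matching_value ?m"
      using stable_surplus[OF st] by (intro matching_value_mono) auto
    then have "efficient V P F \<delta> c E'"
      using efficient_size(2)[OF costly E] by (intro stable_efficient[OF st]) (meson order_trans)
    then show ?thesis by blast
  qed (use E in blast)
qed

text \<open>\<open>r\<close> is the size at which welfare is maximal: 0 on the interval up to
  \<open>isolation_bound\<close>, 1 between \<open>bridge_lower\<close> and
  \<open>bridge_upper\<close>. The assumptions say that the links below \<open>r\<close> are kept
  and that the step from \<open>r\<close> does not raise the welfare.\<close>

context
  fixes r :: nat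
  assumes r: "r \<le> 1" and sustained_below: "r = 1 \<Longrightarrow> sustained 0"
    and no_surplus: "f * surplus r \<le> c"
begin

lemma r_less: "r < q" "1 < q"
  using r card_group[of 1] card_group[of 2] by auto

lemma surplus_below:
  assumes "k < r"
  shows "c < f * surplus k"
proof -
  have k: "k = 0" "r = 1" using assms r by auto
  then have c: "c \<le> f * marginal s1 0" using sustained_below by (simp add: sustained_def)
  also have "\<dots> < f * surplus 0"
    using marginal_less_surplus[of 0 1] f_pos[OF c] by simp
  finally show ?thesis using k by simp
qed

lemma best_r:
  assumes "k \<le> q"
  shows "matching_value k \<le> matching_value r"
proof (cases "k < r")
  case True
  then show ?thesis using surplus_below by (auto intro!: less_imp_le matching_value_strict_mono)
next
  case False
  have "f * surplus i \<le> c" if "r \<le> i" "i < k" for i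
    using surplus_antimono[OF that(1)] that assms no_surplus by simp
  then show ?thesis using False by (intro matching_value_antimono) auto
qed

lemma blocked_r: "blocked r"
proof -
  have "f * marginal (card (P \<alpha>)) r \<le> c" for \<alpha>
    using mult_left_mono[OF marginal_le_surplus[OF r_less(1), of \<alpha>] f_nonneg] no_surplus by simp
  then show ?thesis unfolding blocked_def by (metis not_less)
qed

lemma stable_r:
  assumes "clustered E" "matching E" "card (interconnections P E) = r"
  shows "pairwise_stable V P F \<delta> c E"
proof -
  have "0 < r \<longrightarrow> sustained (r - 1)" using r sustained_below by (cases "r = 1") auto
  then show ?thesis
    using matching_stable_iff[OF costly assms(1,2)] assms(3) blocked_r by simp
qed

lemma efficient_stable_exists: "\<exists>E. efficient V P F \<delta> c E \<and> pairwise_stable V P F \<delta> c E"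
proof -
  obtain E where E: "clustered E" "matching E" "card (interconnections P E) = r"
    using matching_exists[of r] r_less by auto
  then show ?thesis using stable_r matching_efficient[OF costly E(1,2)] best_r by blast
qed

text \<open>\<open>strict\<close> excludes that \<open>r + 1\<close> is optimal as well, since
  \<open>blocked_r\<close> speaks about size \<open>r\<close> only. Then \<open>r\<close> is the
  unique optimal size.\<close>

lemma efficient_imp_stable:
  assumes eff: "efficient V P F \<delta> c E" and strict: "f * surplus r \<noteq> c"
  shows "pairwise_stable V P F \<delta> c E"
proof -
  let ?e = "card (interconnections P E)"
  have le: "matching_value r \<le> matching_value ?e" and eq: "?e \<le> q"
    using efficient_size[OF costly eff] r_less by auto
  have e: "?e = r"
  proof (rule ccontr)
    assume "?e \<noteq> r"
    then consider "?e < r" | "r < ?e" by linarith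
    then show False
    proof cases
      case 1
      then have "matching_value ?e < matching_value r"
        using surplus_below by (intro matching_value_strict_mono) auto
      then show False using le by simp
    next
      case 2
      have "f * surplus i < c" if "r \<le> i" "i < ?e" for i
        using surplus_antimono[OF that(1)] that eq no_surplus strict by simp
      then have "matching_value ?e < matching_value r"
        using 2 by (intro matching_value_strict_antimono) auto
      then show False using le by simp
    qed
  qed
  \<comment> \<open>With at most one interconnection in total, nobody can have two.\<close>
  have "matching E"
    unfolding matching_def
  proof (intro allI impI ballI)
    fix \<alpha> \<beta> i assume "\<alpha> \<noteq> (\<beta>::2)" "i \<in> P \<alpha>"
    then have "card (nbrs E i \<inter> P \<beta>) \<le> ?e"
      using member_le_sum[of i "P \<alpha>" "\<lambda>i. card (nbrs E i \<inter> P \<beta>)"] finite_group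
      by (simp add: card_interconnections)
    then show "card (nbrs E i \<inter> P \<beta>) \<le> 1" using e r by simp
  qed
  then show ?thesis using stable_r efficient_clustered[OF eff] e by blast
qed

text \<open>A stable size above \<open>r\<close> contradicts \<open>no_surplus\<close>: right at
  \<open>r\<close> because \<open>marginal\<close> is strictly below \<open>surplus\<close>, later
  because \<open>surplus\<close> decreases. Size 0 below \<open>r = 1\<close> is stable only if both
  ends of a first link break even, which makes the groups equal and
  \<open>f = c / y1 \<delta> s1\<close>.\<close>

lemma stable_imp_efficient:
  assumes st: "pairwise_stable V P F \<delta> c E"
    and tie: "r = 1 \<Longrightarrow> \<not> (s1 = s2 \<and> f = c / y1 \<delta> s1)"
  shows "efficient V P F \<delta> c E"
proof -
  let ?m = "card (interconnections P E)"
  have "\<not> r < ?m"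
  proof
    assume m: "r < ?m"
    have mq: "?m - 1 < q" and sus: "sustained (?m - 1)" using stable_size[OF st] m by auto
    then have c: "c \<le> f * marginal s1 (?m - 1)" by (simp add: sustained_def)
    have f: "0 < f" using f_pos[OF c] .
    show False
    proof (cases "?m - 1 = r")
      case True
      have "marginal s1 r < surplus r"
        using r r_less by (intro marginal_less_surplus) auto
      then have "f * marginal s1 r < f * surplus r" using f by simp
      then show False using c no_surplus True by simp
    next
      case False
      then have "surplus (?m - 1) < surplus r" using m mq by (intro surplus_strict_antimono) auto
      then have "f * surplus (?m - 1) < f * surplus r" using f by simp
      then show False using sustained_surplus[OF sus mq] no_surplus by simp
    qed
  qed
  moreover have "\<not> ?m < r"
  proof
    assume "?m < r"
    then have m: "?m = 0" "r = 1" using r by auto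
    have "blocked 0" using stable_size(3)[OF st] m r_less by simp
    moreover have ge: "c \<le> f * marginal s1 0" "c \<le> f * marginal s2 0"
      using sustained_below m by (auto simp: sustained_def)
    ultimately have eq: "f * y1 \<delta> s1 = c" "f * y1 \<delta> s2 = c"
      unfolding blocked_def by (auto simp: forall_2 marginal_def)
    then have "y1 \<delta> s1 = y1 \<delta> s2" using f_pos[OF ge(1)] by (metis mult_left_cancel less_irrefl)
    then have "s1 = s2" using delta_pos by (simp add: y1_def)
    moreover have "y1 \<delta> s1 \<noteq> 0" using y1_gt[of 1] delta_pos by simp
    ultimately show False using tie m eq by (auto simp: field_simps)
  qed
  ultimately have "?m = r" by simp
  then show ?thesis using stable_efficient[OF st] best_r by simp
qed

end

lemma isolation_bound_iff:
  "f \<le> isolation_bound \<delta> c s1 s2 \<longleftrightarrow> f * surplus 0 \<le> c"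
  "f = isolation_bound \<delta> c s1 s2 \<longleftrightarrow> f * surplus 0 = c"
proof -
  have "0 < y1 \<delta> s1 * y1 \<delta> s2" using y1_gt[of 1] y1_gt[of 2] delta_pos by (intro mult_pos_pos) auto
  then show "f \<le> isolation_bound \<delta> c s1 s2 \<longleftrightarrow> f * surplus 0 \<le> c"
    "f = isolation_bound \<delta> c s1 s2 \<longleftrightarrow> f * surplus 0 = c"
    using delta_pos by (auto simp: isolation_bound_def surplus_def pos_le_divide_eq eq_divide_eq field_simps)
qed

text \<open>The denominator of \<open>bridge_upper\<close> is \<open>2 * surplus 1\<close>, so the
  bound is where a second matched pair leaves the welfare unchanged.\<close>

lemma bridge_upper_iff:
  "f \<le> bridge_upper \<delta> c s1 s2 \<longleftrightarrow> f * surplus 1 \<le> c"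
  "f = bridge_upper \<delta> c s1 s2 \<longleftrightarrow> f * surplus 1 = c"
proof -
  have "0 < 1 + (real s1 + real s2 - 2 * real 1 - 1) * \<delta>"
    using card_group[of 1] card_group[of 2] delta_pos by (intro add_pos_nonneg mult_nonneg_nonneg) auto
  then have pos: "0 < surplus 1" using y3_pos by (simp add: surplus_def)
  have "y2 \<delta> s2 + y2 \<delta> s1 + (real s1 + real s2 - 4) * \<delta> * y3 \<delta> = 2 * surplus 1"
    by (simp add: surplus_def y1_def y2_def y3_def algebra_simps power2_eq_square)
  then have upper: "bridge_upper \<delta> c s1 s2 = c / surplus 1" by (simp add: bridge_upper_def)
  show "f \<le> bridge_upper \<delta> c s1 s2 \<longleftrightarrow> f * surplus 1 \<le> c"
    "f = bridge_upper \<delta> c s1 s2 \<longleftrightarrow> f * surplus 1 = c"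
    using pos unfolding upper by (simp_all add: pos_le_divide_eq eq_divide_eq)
qed

lemma bridge_lower_sustained:
  assumes "bridge_lower \<delta> c s1 s2 \<le> f"
  shows "sustained 0"
proof -
  have "0 < y1 \<delta> s1" "0 < y1 \<delta> s2" using y1_gt[of 1] y1_gt[of 2] delta_pos by auto
  moreover have "c / y1 \<delta> s1 \<le> f" "c / y1 \<delta> s2 \<le> f" using assms by (auto simp: bridge_lower_def)
  ultimately show ?thesis by (simp add: sustained_def forall_2 marginal_def pos_divide_le_eq)
qed

end

section \<open>Combining the regimes of \<open>f\<close>\<close>

lemma (in two_groups) coincidence:
  assumes range: "f \<in> {0..isolation_bound \<delta> c s1 s2}
    \<union> {bridge_lower \<delta> c s1 s2..bridge_upper \<delta> c s1 s2} \<union> {c / y3 \<delta>..1}"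
  shows "\<exists>E. efficient V P F \<delta> c E \<and> pairwise_stable V P F \<delta> c E"
    and "\<lbrakk>f \<noteq> isolation_bound \<delta> c s1 s2; f \<noteq> bridge_upper \<delta> c s1 s2; efficient V P F \<delta> c E\<rbrakk>
      \<Longrightarrow> pairwise_stable V P F \<delta> c E"
    and "\<lbrakk>\<not> (s1 = s2 \<and> f = bridge_lower \<delta> c s1 s2); pairwise_stable V P F \<delta> c E\<rbrakk>
      \<Longrightarrow> efficient V P F \<delta> c E"
proof -
  have "(\<exists>E. efficient V P F \<delta> c E \<and> pairwise_stable V P F \<delta> c E) \<and>
    (f \<noteq> isolation_bound \<delta> c s1 s2 \<longrightarrow> f \<noteq> bridge_upper \<delta> c s1 s2 \<longrightarrow> efficient V P F \<delta> c E
      \<longrightarrow> pairwise_stable V P F \<delta> c E) \<and>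
    (\<not> (s1 = s2 \<and> f = bridge_lower \<delta> c s1 s2) \<longrightarrow> pairwise_stable V P F \<delta> c E
      \<longrightarrow> efficient V P F \<delta> c E)"
  proof (cases "c \<le> f * y3 \<delta>")
    case True
    then show ?thesis
      using efficient_iff_stable[OF True] efficient_exists[OF finite_V, of P F \<delta> c] by blast
  next
    case False
    then interpret costly_links V P F \<delta> c by unfold_locales simp
    have "f < c / y3 \<delta>" using costly y3_pos by (simp add: pos_less_divide_eq)
    then consider "f \<le> isolation_bound \<delta> c s1 s2"
      | "bridge_lower \<delta> c s1 s2 \<le> f" "f \<le> bridge_upper \<delta> c s1 s2"
      using range by auto
    then show ?thesis
    proof cases
      case 1
      then have r: "(0::nat) \<le> 1" "(0::nat) = 1 \<Longrightarrow> sustained 0" "f * surplus 0 \<le> c"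
        using isolation_bound_iff by auto
      show ?thesis
      proof (intro conjI impI)
        show "\<exists>E. efficient V P F \<delta> c E \<and> pairwise_stable V P F \<delta> c E"
          using r by (rule efficient_stable_exists)
        assume "f \<noteq> isolation_bound \<delta> c s1 s2" "efficient V P F \<delta> c E"
        then show "pairwise_stable V P F \<delta> c E"
          using efficient_imp_stable[OF r] isolation_bound_iff(2) by metis
      next
        assume "pairwise_stable V P F \<delta> c E"
        then show "efficient V P F \<delta> c E" 
          using stable_imp_efficient[of 0 E] r by simp
      qed
    next
      case 2
      then have r: "(1::nat) \<le> 1" "(1::nat) = 1 \<Longrightarrow> sustained 0" "f * surplus 1 \<le> c"
        using bridge_upper_iff bridge_lower_sustained by auto
      show ?thesis
      proof (intro conjI impI)
        show "\<exists>E. efficient V P F \<delta> c E \<and> pairwise_stable V P F \<delta> c E"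
          using r by (rule efficient_stable_exists)
        assume "f \<noteq> bridge_upper \<delta> c s1 s2" "efficient V P F \<delta> c E"
        then show "pairwise_stable V P F \<delta> c E"
          using efficient_imp_stable[OF r] bridge_upper_iff(2) by metis
      next
        assume "\<not> (s1 = s2 \<and> f = bridge_lower \<delta> c s1 s2)" "pairwise_stable V P F \<delta> c E"
        moreover have "bridge_lower \<delta> c s1 s2 = c / y1 \<delta> s1" if "s1 = s2"
          using that by (simp add: bridge_lower_def)
        ultimately show "efficient V P F \<delta> c E"
          using stable_imp_efficient[of 1 E] r by metis
      qed
    qed
  qed
  then show "\<exists>E. efficient V P F \<delta> c E \<and> pairwise_stable V P F \<delta> c E"
    and "\<lbrakk>f \<noteq> isolation_bound \<delta> c s1 s2; f \<noteq> bridge_upper \<delta> c s1 s2; efficient V P F \<delta> c E\<rbrakk>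
      \<Longrightarrow> pairwise_stable V P F \<delta> c E"
    and "\<lbrakk>\<not> (s1 = s2 \<and> f = bridge_lower \<delta> c s1 s2); pairwise_stable V P F \<delta> c E\<rbrakk>
      \<Longrightarrow> efficient V P F \<delta> c E" by blast+
qed

text \<open>For \<open>c \<le> f * y3 \<delta>\<close> efficient and stable networks are the same,
  so each is its own witness. At equality they differ in size among themselves, which is why the
  first claim excludes \<open>c / y3 \<delta>\<close>.\<close>

lemma (in two_groups) comparison:
  shows "\<lbrakk>f \<noteq> c / y3 \<delta>; \<not> (s1 = s2 \<and> f = c / ((1 + \<delta>) * y3 \<delta>));
      efficient V P F \<delta> c E; pairwise_stable V P F \<delta> c E'\<rbrakk>
      \<Longrightarrow> card (interconnections P E') \<le> card (interconnections P E)"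
    and "efficient V P F \<delta> c E \<Longrightarrow> \<exists>E'. pairwise_stable V P F \<delta> c E' \<and>
      card (interconnections P E') \<le> card (interconnections P E)"
    and "pairwise_stable V P F \<delta> c E' \<Longrightarrow> \<exists>E. efficient V P F \<delta> c E \<and>
      card (interconnections P E') \<le> card (interconnections P E)"
proof -
  consider "c = f * y3 \<delta>" | "c < f * y3 \<delta>" | "costly_links V P F \<delta> c"
    using two_groups_axioms by (fastforce simp: costly_links_def costly_links_axioms_def)
  note cases = this
  show "card (interconnections P E') \<le> card (interconnections P E)"
    if "f \<noteq> c / y3 \<delta>" "\<not> (s1 = s2 \<and> f = c / ((1 + \<delta>) * y3 \<delta>))"
      "efficient V P F \<delta> c E" "pairwise_stable V P F \<delta> c E'"
    using cases
  proof cases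
    case 1
    then show ?thesis using that(1) y3_pos by simp
  next
    case 2
    then show ?thesis using that efficient_iff_complete stable_iff_complete by simp
  next
    case 3
    then show ?thesis using that costly_links.efficient_ge_stable by blast
  qed
  show "\<exists>E'. pairwise_stable V P F \<delta> c E' \<and> card (interconnections P E') \<le> card (interconnections P E)"
    if "efficient V P F \<delta> c E"
    using cases that efficient_iff_stable costly_links.stable_le_efficient
    by (cases; fastforce)
  show "\<exists>E. efficient V P F \<delta> c E \<and> card (interconnections P E') \<le> card (interconnections P E)"
    if "pairwise_stable V P F \<delta> c E'"
    using cases that efficient_iff_stable costly_links.efficient_ge_some_stable
    by (cases; fastforce)
qed

theorem mainTheorem5:
  fixes V :: "'a set" and P :: "2 \<Rightarrow> 'a set" and F :: "real^2^2"
    and \<delta> c :: real and n s1 s2 :: nat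
  assumes "finite V" and "card V = n"
    and "P 1 \<union> P 2 = V" and "P 1 \<inter> P 2 = {}"
    and "card (P 1) = s1" and "card (P 2) = s2"
    and "s1 \<ge> 3" and "s2 \<ge> 3"
    and "transpose F = F" and "\<forall>\<alpha> \<beta>. F $ \<alpha> $ \<beta> \<in> {0..1}" and "\<forall>\<alpha>. F $ \<alpha> $ \<alpha> = 1"
    and "0 < \<delta>" and "\<delta> < 1"
    and "c < y3 \<delta>"
  shows
    "\<comment> \<open>comparison of the numbers of interconnections\<close>
     (F $ 1 $ 2 \<noteq> c / y3 \<delta> \<and> \<not> (s1 = s2 \<and> F $ 1 $ 2 = c / ((1 + \<delta>) * y3 \<delta>)) \<longrightarrow>
        (\<forall>E E'. efficient V P F \<delta> c E \<and> pairwise_stable V P F \<delta> c E' \<longrightarrow>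
           card (interconnections P E) \<ge> card (interconnections P E'))) \<and>
     (\<forall>E. efficient V P F \<delta> c E \<longrightarrow>
        (\<exists>E'. pairwise_stable V P F \<delta> c E' \<and>
           card (interconnections P E) \<ge> card (interconnections P E'))) \<and>
     (\<forall>E'. pairwise_stable V P F \<delta> c E' \<longrightarrow>
        (\<exists>E. efficient V P F \<delta> c E \<and>
           card (interconnections P E) \<ge> card (interconnections P E'))) \<and>
     \<comment> \<open>coincidence of the efficient and the pairwise stable structures\<close>
     (\<delta> \<ge> (MAX s\<in>{s1, s2}. (real s - 3) / (real n - 3)) \<and>
        F $ 1 $ 2 \<in> {0..isolation_bound \<delta> c s1 s2}
          \<union> {bridge_lower \<delta> c s1 s2..bridge_upper \<delta> c s1 s2}
          \<union> {c / y3 \<delta>..1}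
      \<or> \<delta> < (MAX s\<in>{s1, s2}. (real s - 3) / (real n - 3)) \<and>
        F $ 1 $ 2 \<in> {0..isolation_bound \<delta> c s1 s2} \<union> {c / y3 \<delta>..1}
      \<longrightarrow>
        (\<exists>E. efficient V P F \<delta> c E \<and> pairwise_stable V P F \<delta> c E) \<and>
        (F $ 1 $ 2 \<noteq> isolation_bound \<delta> c s1 s2 \<and> F $ 1 $ 2 \<noteq> bridge_upper \<delta> c s1 s2 \<longrightarrow>
           (\<forall>E. efficient V P F \<delta> c E \<longrightarrow> pairwise_stable V P F \<delta> c E)) \<and>
        (\<not> (s1 = s2 \<and> F $ 1 $ 2 = bridge_lower \<delta> c s1 s2) \<longrightarrow>
           (\<forall>E. pairwise_stable V P F \<delta> c E \<longrightarrow> efficient V P F \<delta> c E)))"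
proof -
  interpret two_groups V P F \<delta> c
  proof
    show "3 \<le> card (P \<alpha>)" for \<alpha>
      using assms exhaust_2[of \<alpha>] by auto
  qed (use assms in auto)
  show ?thesis
    using comparison[unfolded assms(5,6)] coincidence[unfolded assms(5,6)] by blast
qed

end
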